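(* Let $\Psi(\tau)=\tau\int_0^\tau e^{-x^2/2}\,dx+e^{-\tau^2/2}$ for $\tau\ge0$. For $f=0$ the functions $\mathbb M$ and $\mathbb L$ are given as follows. For all $F\ge0$ and $\lambda>0$, $$\mathbb M(0,F,\lambda)=\begin{cases}\dfrac{F}{\mathbb L(0,1,\lambda)}=\dfrac{F}{\sqrt\lambda}\,\Psi(1), & \text{if } F\le\dfrac{\sqrt\lambda}{\Psi(1)},\\[3mm] 1, & \text{if } F>\dfrac{\sqrt\lambda}{\Psi(1)},\end{cases}$$ and for all $p\in[0,1]$ and $\lambda>0$, $$\mathbb L(0,p,\lambda)=p\,\mathbb L(0,1,\lambda)=\frac{p\sqrt\lambda}{\Psi(1)}.$$
   Context: $\mathcal D$ denotes the standard collection of dyadic intervals of $\mathbb R$. For $I\in\mathcal D$, $I_-$ and $I_+$ are its left and right halves, $\mathbf 1_I$ its indicator function, and $|E|$ denotes Lebesgue measure. For integrable $\varphi$, $\langle\varphi\rangle_I=\frac1{|I|}\int_I\varphi\,dx$. Functions are real-valued. For $J\in\mathcal D$ the (localized) dyadic square function is given by $$S_J^2\varphi(x)=\sum_{I\in\mathcal D,\ I\subseteq J}|\Delta_I\varphi|^2\,\mathbf 1_I(x),\qquad \Delta_I\varphi=\tfrac12\big(\langle\varphi\rangle_{I_+}-\langle\varphi\rangle_{I_-}\big)\big(\mathbf 1_{I_+}-\mathbf 1_{I_-}\big).$$ For $f\in\mathbb R$, $F\ge|f|$, $\lambda>0$, $$\mathbb M(f,F,\lambda)=\sup\frac1{|J|}|\{x\in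 J:S_J^2\varphi(x)\ge\lambda\}|,$$ the supremum being over all integrable $\varphi$ supported in $J\in\mathcal D$ with $\langle\varphi\rangle_J=f$ and $\langle|\varphi|\rangle_J=F$. For $f\in\mathbb R$, $0\le p\le1$, $\lambda>0$, $$\mathbb L(f,p,\lambda)=\inf\langle|\varphi|\rangle_J,$$ the infimum being over all integrable $\varphi$ supported in $J\in\mathcal D$ with $\langle\varphi\rangle_J=f$ and $\frac1{|J|}|\{x\in J:S_J^2\varphi(x)\ge\lambda\}|=p$. Neither quantity depends on the choice of $J$. *)

theory Defs
  imports "HOL-Analysis.Analysis"
begin

text \<open>Dyadic intervals are taken half-open, so that each generation partitions the line and
  the halves of a dyadic interval are again dyadic.\<close>

definition dyadic :: "real set set" where
  "dyadic = {{of_int k * 2 powi n ..< of_int (k + 1) * 2 powi n} | k n :: int. True}"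

definition left_half :: "real set \<Rightarrow> real set" where
  "left_half I = {Inf I ..< (Inf I + Sup I) / 2}"

definition right_half :: "real set \<Rightarrow> real set" where
  "right_half I = {(Inf I + Sup I) / 2 ..< Sup I}"

definition avg :: "real set \<Rightarrow> (real \<Rightarrow> real) \<Rightarrow> real" where
  "avg I \<phi> = (1 / measure lebesgue I) * (LINT x:I|lebesgue. \<phi> x)"

definition mart_diff :: "real set \<Rightarrow> (real \<Rightarrow> real) \<Rightarrow> real \<Rightarrow> real" where
  "mart_diff I \<phi> x = (1/2) * (avg (right_half I) \<phi> - avg (left_half I) \<phi>)
     * (indicator (right_half I) x - indicator (left_half I) x)"

text \<open>The squared square function takes values in \<open>[0, \<infinity>]\<close>: the series may
  diverge at individual points, and such points belong to every superlevel set.\<close>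

definition sq_fun2 :: "real set \<Rightarrow> (real \<Rightarrow> real) \<Rightarrow> real \<Rightarrow> ennreal" where
  "sq_fun2 J \<phi> x =
     (\<Sum>\<^sub>\<infinity>I\<in>{I \<in> dyadic. I \<subseteq> J}. ennreal (\<bar>mart_diff I \<phi> x\<bar>\<^sup>2 * indicator I x))"

definition integrable_supp :: "real set \<Rightarrow> (real \<Rightarrow> real) \<Rightarrow> bool" where
  "integrable_supp J \<phi> \<longleftrightarrow> integrable lebesgue \<phi> \<and> (\<forall>x. x \<notin> J \<longrightarrow> \<phi> x = 0)"

definition level_frac :: "real set \<Rightarrow> (real \<Rightarrow> real) \<Rightarrow> real \<Rightarrow> real" where
  "level_frac J \<phi> lam =
     (1 / measure lebesgue J) * measure lebesgue {x \<in> J. sq_fun2 J \<phi> x \<ge> ennreal lam}"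

text \<open>The two extremal functions, with the base interval \<open>J\<close> kept as an explicit argument.
  The supremum is over a subset of \<open>[0, 1]\<close> and the infimum over a set of
  nonnegative reals; for the parameters \<open>\<bar>f\<bar> \<le> F\<close>, \<open>0 \<le> p \<le> 1\<close>, \<open>lam > 0\<close>
  of interest both sets are nonempty.\<close>

definition bellman_M :: "real set \<Rightarrow> real \<Rightarrow> real \<Rightarrow> real \<Rightarrow> real" where
  "bellman_M J f F lam =
     Sup {level_frac J \<phi> lam | \<phi>.
            integrable_supp J \<phi> \<and> avg J \<phi> = f \<and> avg J (\<lambda>x. \<bar>\<phi> x\<bar>) = F}"

definition bellman_L :: "real set \<Rightarrow> real \<Rightarrow> real \<Rightarrow> real \<Rightarrow> real" where
  "bellman_L J f p lam =
     Inf {avg J (\<lambda>x. \<bar>\<phi> x\<bar>) | \<phi>.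
            integrable_supp J \<phi> \<and> avg J \<phi> = f \<and> level_frac J \<phi> lam = p}"

definition Psi :: "real \<Rightarrow> real" where
  "Psi \<tau> = \<tau> * integral {0..\<tau>} (\<lambda>x. exp (- (x\<^sup>2 / 2))) + exp (- (\<tau>\<^sup>2 / 2))"

end

(* Splitting J into its halves replaces (average f, level l) by (f - d, l - d^2) and (f + d, l - d^2),
   where d is the jump of the averages.  Hence a lower bound for the L^1 norm needs a function B with
   B(x, l) <= (B(x + d, l - d^2) + B(x - d, l - d^2)) / 2 and B(x, l) = |x| for l <= x^2.  As d -> 0 this
   becomes the heat equation u_l = u_xx / 2 in x^2 < l, whose self-similar solution with boundary
   values |x| is u(x, l) = sqrt l Psi(x / sqrt l) / Psi(1).  Along s -> (x + s, l - s^2) and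
   (x - s, l - s^2) the derivative of the average of u is an error of the trapezoidal rule for
   exp(-y^2/2); concavity on [-1, 1] gives its sign, and its quadratic size shows that small steps
   lose nothing in the limit, so that the bound is approached by finite dyadic martingales.  A general
   level fraction p is realised by placing copies on dyadic subintervals according to the binary
   expansion of p. *)
theory Submission
  imports Defs
begin

section \<open>The main inequality\<close>

text \<open>Jumps are not small, so one split may leave the parabola x^2 < l. Its boundary is x /
  sqrt l = 1 or -1, exactly the inflection points of the Gaussian, so the concavity argument stops
  there and such splits need a slope estimate instead. In the construction by small steps the
  overshoot is paid by a slack term proportional to sqrt l, which drops at every split. The
  linearity in p rests on a further property of the candidate: it exceeds |x| by at most its value
  sqrt l / Psi(1) at x = 0. Points whose square function stays below the level are charged this
  amount per unit of measure. Since f = 0, the starting value is the same constant, and the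
  difference is sqrt l / Psi(1) times the measure of the level set.\<close>

text \<open>An antiderivative on the whole line is used because \<open>integral {0..x}\<close>, hence \<open>Psi\<close>, is junk
  for \<open>x < 0\<close>; \<open>psi\<close> below is the even extension of \<open>Psi\<close>.\<close>

definition gauss_int :: "real \<Rightarrow> real" where
  "gauss_int = (SOME F. F 0 = 0 \<and> (\<forall>x. (F has_real_derivative exp (- (x\<^sup>2 / 2))) (at x)))"

lemma gauss_int: "gauss_int 0 = 0" "(gauss_int has_real_derivative exp (- (x\<^sup>2 / 2))) (at x)"
proof -
  obtain F :: "real \<Rightarrow> real" where F: "\<And>x. (F has_vector_derivative exp (- (x\<^sup>2 / 2))) (at x)"
    using einterval_antiderivative[of "-\<infinity>" "\<infinity>" "\<lambda>x::real. exp (- (x\<^sup>2 / 2))"]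
    by (auto intro!: continuous_intros)
  define H where "H = (\<lambda>x. F x - F 0)"
  have H: "H 0 = 0 \<and> (\<forall>x. (H has_real_derivative exp (- (x\<^sup>2 / 2))) (at x))"
    unfolding H_def
    by (auto intro!: derivative_eq_intros
        F[unfolded has_real_derivative_iff_has_vector_derivative[symmetric]])
  have "gauss_int 0 = 0 \<and> (\<forall>x. (gauss_int has_real_derivative exp (- (x\<^sup>2 / 2))) (at x))"
    unfolding gauss_int_def by (rule someI[where x = H]) (rule H)
  then show "gauss_int 0 = 0" "(gauss_int has_real_derivative exp (- (x\<^sup>2 / 2))) (at x)" by auto
qed

lemma gauss_int_chain [derivative_intros]:
  assumes "(g has_real_derivative g') (at x within S)"
  shows "((\<lambda>x. gauss_int (g x)) has_real_derivative exp (- ((g x)\<^sup>2 / 2)) * g') (at x within S)"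
  by (rule DERIV_chain2[OF gauss_int(2) assms])

lemma gauss_int_minus: "gauss_int (- x) = - gauss_int x"
proof -
  have "((\<lambda>x. gauss_int x + gauss_int (- x)) has_real_derivative 0) (at y)" for y
    by (auto intro!: derivative_eq_intros gauss_int(2))
  then have "gauss_int x + gauss_int (- x) = gauss_int 0 + gauss_int (- 0)"
    by (intro DERIV_isconst_all[of "\<lambda>x. gauss_int x + gauss_int (- x)" x 0]) blast
  then show ?thesis by (simp add: gauss_int)
qed

lemma deriv_nonneg_imp_le:
  fixes f :: "real \<Rightarrow> real"
  assumes "a \<le> b" "\<And>x. a \<le> x \<Longrightarrow> x \<le> b \<Longrightarrow> (f has_real_derivative f' x) (at x)"
    "\<And>x. a \<le> x \<Longrightarrow> x \<le> b \<Longrightarrow> 0 \<le> f' x"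
  shows "f a \<le> f b"
  using assms by (intro DERIV_nonneg_imp_nondecreasing[of a b f]) blast+

lemma gauss_int_mono: "x \<le> y \<Longrightarrow> gauss_int x \<le> gauss_int y"
  by (rule deriv_nonneg_imp_le[OF _ gauss_int(2)]) auto

definition psi :: "real \<Rightarrow> real" where
  "psi x = x * gauss_int x + exp (- (x\<^sup>2 / 2))"

lemma psi_deriv: "(psi has_real_derivative gauss_int x) (at x)"
proof -
  have "((\<lambda>x. x * gauss_int x + exp (- (x\<^sup>2 / 2))) has_real_derivative gauss_int x) (at x)"
    by (auto intro!: derivative_eq_intros gauss_int(2) simp: field_simps)
  then show ?thesis
    by (simp add: psi_def[abs_def])
qed

lemma psi_chain [derivative_intros]:
  assumes "(g has_real_derivative g') (at x within S)"
  shows "((\<lambda>x. psi (g x)) has_real_derivative gauss_int (g x) * g') (at x within S)"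
  by (rule DERIV_chain2[OF psi_deriv assms])

lemma psi_minus [simp]: "psi (- x) = psi x"
  by (simp add: psi_def gauss_int_minus)

lemma psi_abs [simp]: "psi \<bar>x\<bar> = psi x"
  by (simp add: abs_if)

lemma psi_0 [simp]: "psi 0 = 1"
  by (simp add: psi_def)

lemma Psi_1: "Psi 1 = psi 1"
proof -
  have "((\<lambda>x. exp (- (x\<^sup>2 / 2))) has_integral gauss_int 1 - gauss_int 0) {0..1}"
    by (rule fundamental_theorem_of_calculus)
       (auto simp: has_real_derivative_iff_has_vector_derivative[symmetric]
             intro: has_field_derivative_at_within gauss_int)
  then show ?thesis
    by (simp add: Psi_def psi_def gauss_int integral_unique)
qed

lemma psi_mono:
  assumes "\<bar>x\<bar> \<le> \<bar>y\<bar>"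
  shows "psi x \<le> psi y"
proof -
  have "psi \<bar>x\<bar> \<le> psi \<bar>y\<bar>"
    using gauss_int_mono[of 0] gauss_int(1)
    by (intro deriv_nonneg_imp_le[OF assms psi_deriv]) simp
  then show ?thesis by simp
qed

lemma psi_ge_1: "1 \<le> psi x"
  using psi_mono[of 0 x] by simp

lemma psi_pos: "0 < psi x"
  using psi_ge_1[of x] by linarith

text \<open>The left side has derivative (1 - x) exp(-x^2/2), so it increases up to 1, where it
  equals \<open>psi 1\<close>. It bounds the slope of \<open>heat\<close> when position and level
  grow together.\<close>

lemma gauss_int_le_psi_1:
  assumes "x \<le> 1"
  shows "gauss_int x + exp (- (x\<^sup>2 / 2)) \<le> psi 1"
proof -
  have "((\<lambda>x. gauss_int x + exp (- (x\<^sup>2 / 2))) has_real_derivative exp (- (y\<^sup>2 / 2)) * (1 - y)) (at y)" for y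
    by (auto intro!: derivative_eq_intros gauss_int(2) simp: algebra_simps)
  from deriv_nonneg_imp_le[OF assms this]
  have "gauss_int x + exp (- (x\<^sup>2 / 2)) \<le> gauss_int 1 + exp (- (1\<^sup>2 / 2))"
    by simp
  then show ?thesis by (simp add: psi_def)
qed

text \<open>Since the derivative \<open>gauss_int\<close> of \<open>psi\<close> is at most
  \<open>psi 1\<close> on [0, 1], \<open>psi 1 * x - psi x\<close> is nondecreasing there; its end
  values -1 and 0 give the two linear bounds.\<close>

lemma psi_bounds:
  assumes "\<bar>x\<bar> \<le> 1"
  shows "psi 1 * \<bar>x\<bar> \<le> psi x" "psi x \<le> psi 1" "psi x \<le> psi 1 * \<bar>x\<bar> + 1"
proof -
  have d: "((\<lambda>x. psi 1 * x - psi x) has_real_derivative psi 1 - gauss_int y) (at y)" for y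
    by (rule derivative_eq_intros psi_deriv refl)+ simp
  have n: "0 \<le> psi 1 - gauss_int y" if "y \<le> 1" for y
    using gauss_int_le_psi_1[OF that] exp_ge_zero[of "- (y\<^sup>2 / 2)"] by linarith
  show "psi 1 * \<bar>x\<bar> \<le> psi x"
    using deriv_nonneg_imp_le[OF assms d] n by fastforce
  show "psi x \<le> psi 1 * \<bar>x\<bar> + 1"
    using deriv_nonneg_imp_le[OF abs_ge_zero[of x] d] n assms by fastforce
  show "psi x \<le> psi 1" using psi_mono[of x 1] assms by simp
qed

section \<open>The self-similar heat solution and the trapezoidal error\<close>

definition heat :: "real \<Rightarrow> real \<Rightarrow> real" where
  "heat x l = sqrt l * psi (x / sqrt l)"

text \<open>The coefficients of X' and l' are the partial derivatives of \<open>heat\<close>. In the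
  second one the \<open>gauss_int\<close> terms cancel, which leaves half the second x-derivative:
  the heat equation.\<close>

lemma heat_deriv:
  assumes "(X has_real_derivative X') (at s within S)" "(l has_real_derivative l') (at s within S)" "l s > 0"
  shows "((\<lambda>s. heat (X s) (l s)) has_real_derivative
     gauss_int (X s / sqrt (l s)) * X' + exp (- ((X s / sqrt (l s))\<^sup>2 / 2)) * (l' / (2 * sqrt (l s)))) (at s within S)"
proof -
  define q where "q = sqrt (l s)"
  have q: "q > 0" using assms(3) by (simp add: q_def)
  have e: "l s = q * q" using assms(3) by (simp add: q_def)
  have D: "((\<lambda>s. sqrt (l s)) has_real_derivative l' / (2 * q)) (at s within S)"
    using DERIV_chain2[OF DERIV_real_sqrt assms(2)] assms(3) by (simp add: q_def field_simps)
  have "((\<lambda>s. sqrt (l s) * psi (X s / sqrt (l s))) has_real_derivative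
     l' / (2 * q) * psi (X s / q) + gauss_int (X s / q) * ((X' * q - X s * (l' / (2 * q))) / (q * q)) * q) (at s within S)"
    using DERIV_mult[OF D psi_chain[OF DERIV_divide[OF assms(1) D]]] q by (simp add: q_def)
  moreover have "l' / (2 * q) * psi (X s / q) + gauss_int (X s / q) * ((X' * q - X s * (l' / (2 * q))) / (q * q)) * q
     = gauss_int (X s / q) * X' + exp (- ((X s / q)\<^sup>2 / 2)) * (l' / (2 * q))"
    unfolding psi_def using q by (simp add: field_simps)
  ultimately show ?thesis
    unfolding heat_def q_def by simp
qed

lemma heat_scale:
  assumes "t > 0"
  shows "heat (t * x) (t\<^sup>2 * l) = t * heat x l"
  using assms by (auto simp: heat_def real_sqrt_mult)

text \<open>The function of h is the Gaussian integral over [c - h, c + h] minus its trapezoidal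
  approximation. It vanishes at h = 0, so bounds follow from its derivative.\<close>

lemma trapezoid_deriv:
  "((\<lambda>h. gauss_int (c + h) - gauss_int (c - h) - h * (exp (- ((c + h)\<^sup>2 / 2)) + exp (- ((c - h)\<^sup>2 / 2))))
     has_real_derivative h * ((c + h) * exp (- ((c + h)\<^sup>2 / 2)) - (c - h) * exp (- ((c - h)\<^sup>2 / 2)))) (at h)"
  by (auto intro!: derivative_eq_intros simp: field_simps)

text \<open>Up to sign, x exp(-x^2/2) is the derivative of the Gaussian, so this is concavity
  between the inflection points.\<close>

lemma mult_exp_mono:
  assumes "-1 \<le> x" "x \<le> y" "y \<le> (1::real)"
  shows "x * exp (- (x\<^sup>2 / 2)) \<le> y * exp (- (y\<^sup>2 / 2))"
proof -
  have d: "((\<lambda>x. x * exp (- (x\<^sup>2 / 2))) has_real_derivative exp (- (z\<^sup>2 / 2)) * (1 - z\<^sup>2)) (at z)" for z :: real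
    by (auto intro!: derivative_eq_intros simp: algebra_simps power2_eq_square)
  have "z\<^sup>2 \<le> 1" if "x \<le> z" "z \<le> y" for z
    using that assms by (simp add: abs_square_le_1)
  then show ?thesis
    by (intro deriv_nonneg_imp_le[OF assms(2) d] mult_nonneg_nonneg) auto
qed

lemma abs_mult_exp_le_1: "\<bar>x * exp (- (x\<^sup>2 / 2))\<bar> \<le> (1::real)"
proof -
  have "\<bar>x\<bar> \<le> 1 + x\<^sup>2 / 2"
    using zero_le_power2[of "\<bar>x\<bar> - 1"] by (simp add: power2_eq_square algebra_simps)
  also have "\<dots> \<le> exp (x\<^sup>2 / 2)" by (rule exp_ge_add_one_self)
  finally show ?thesis by (simp add: abs_mult exp_minus field_simps)
qed

lemma trapezoid_nonneg:
  assumes "0 \<le> h" "-1 \<le> c - h" "c + h \<le> 1"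
  shows "h * (exp (- ((c + h)\<^sup>2 / 2)) + exp (- ((c - h)\<^sup>2 / 2))) \<le> gauss_int (c + h) - gauss_int (c - h)"
proof -
  let ?k = "\<lambda>h. gauss_int (c + h) - gauss_int (c - h) - h * (exp (- ((c + h)\<^sup>2 / 2)) + exp (- ((c - h)\<^sup>2 / 2)))"
  have "?k 0 \<le> ?k h"
  proof (rule deriv_nonneg_imp_le[OF assms(1) trapezoid_deriv])
    fix x assume x: "0 \<le> x" "x \<le> h"
    show "0 \<le> x * ((c + x) * exp (- ((c + x)\<^sup>2 / 2)) - (c - x) * exp (- ((c - x)\<^sup>2 / 2)))"
      using mult_exp_mono[of "c - x" "c + x"] x assms by (intro mult_nonneg_nonneg) auto
  qed
  then show ?thesis by simp
qed

text \<open>The centre c is unrestricted because a landing point of a small step may lie outside the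
  parabola. Each product in the derivative is bounded crudely by 1, whence h^2.\<close>

lemma trapezoid_upper:
  assumes "0 \<le> h"
  shows "gauss_int (c + h) - gauss_int (c - h) - h * (exp (- ((c + h)\<^sup>2 / 2)) + exp (- ((c - h)\<^sup>2 / 2))) \<le> h\<^sup>2"
proof -
  let ?k = "\<lambda>h. gauss_int (c + h) - gauss_int (c - h) - h * (exp (- ((c + h)\<^sup>2 / 2)) + exp (- ((c - h)\<^sup>2 / 2)))"
  have "?k h - h\<^sup>2 \<le> ?k 0 - 0\<^sup>2"
  proof (rule DERIV_nonpos_imp_nonincreasing[OF assms], intro exI conjI)
    fix x :: real assume x: "0 \<le> x"
    show "((\<lambda>h. ?k h - h\<^sup>2) has_real_derivative 
       x * ((c + x) * exp (- ((c + x)\<^sup>2 / 2)) - (c - x) * exp (- ((c - x)\<^sup>2 / 2))) - 2 * x) (at x)"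
      by (rule DERIV_diff[OF trapezoid_deriv]) (auto intro!: derivative_eq_intros)
    have "(c + x) * exp (- ((c + x)\<^sup>2 / 2)) - (c - x) * exp (- ((c - x)\<^sup>2 / 2)) \<le> 2"
      using abs_mult_exp_le_1[of "c + x"] abs_mult_exp_le_1[of "c - x"] by linarith
    from mult_left_mono[OF this x] 
    show "x * ((c + x) * exp (- ((c + x)\<^sup>2 / 2)) - (c - x) * exp (- ((c - x)\<^sup>2 / 2))) - 2 * x \<le> 0"
      by (simp add: mult.commute)
  qed
  then show ?thesis by simp
qed

lemma heat_pair_deriv:
  assumes "s\<^sup>2 < l"
  shows "((\<lambda>s. heat (x + s) (l - s\<^sup>2) + heat (x - s) (l - s\<^sup>2)) has_real_derivative
     (let c = x / sqrt (l - s\<^sup>2); h = s / sqrt (l - s\<^sup>2) in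
      gauss_int (c + h) - gauss_int (c - h) - h * (exp (- ((c + h)\<^sup>2 / 2)) + exp (- ((c - h)\<^sup>2 / 2))))) (at s)"
proof -
  have dx: "((\<lambda>s. x + s) has_real_derivative 1) (at s)" "((\<lambda>s. x - s) has_real_derivative -1) (at s)"
       "((\<lambda>s. l - s\<^sup>2) has_real_derivative - (2 * s)) (at s)"
    by (auto intro!: derivative_eq_intros)
  show ?thesis
    by (rule DERIV_cong[OF DERIV_add[OF heat_deriv[OF dx(1) dx(3)] heat_deriv[OF dx(2) dx(3)]]])
      (use assms in \<open>auto simp: Let_def add_divide_distrib diff_divide_distrib algebra_simps\<close>)
qed


text \<open>The candidate for \<open>L(x, 1, l)\<close>; levels \<open>l \<le> 0\<close> occur once the square function has passed the level.\<close>

definition bell :: "real \<Rightarrow> real \<Rightarrow> real" where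
  "bell x l = (if l \<le> x\<^sup>2 then \<bar>x\<bar> else heat x l / psi 1)"

section \<open>Bounds for the candidate and its inequality under one split\<close>

lemma heat_minus [simp]: "heat (- x) l = heat x l"
  by (simp add: heat_def)

lemma bell_minus [simp]: "bell (- x) l = bell x l"
  by (simp add: bell_def)

lemma sq_le_imp_abs_div_sqrt_le:
  assumes "0 < l" "x\<^sup>2 \<le> l"
  shows "\<bar>x / sqrt l\<bar> \<le> 1"
  using assms real_le_rsqrt[of "\<bar>x\<bar>" l] by simp

lemma heat_boundary:
  assumes "0 < q"
  shows "heat q (q\<^sup>2) = psi 1 * q"
  using assms by (simp add: heat_def)

lemma bell_eq_heat:
  assumes "0 < l" "x\<^sup>2 \<le> l"
  shows "bell x l = heat x l / psi 1"
proof (cases "l = x\<^sup>2")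
  case True
  then have "heat \<bar>x\<bar> (\<bar>x\<bar>\<^sup>2) = psi 1 * \<bar>x\<bar>" using assms by (intro heat_boundary) auto
  then show ?thesis using True psi_pos[of 1] by (auto simp: bell_def abs_if split: if_splits)
qed (use assms in \<open>auto simp: bell_def\<close>)

lemma heat_bounds:
  assumes "0 < l" "x\<^sup>2 \<le> l"
  shows "psi 1 * \<bar>x\<bar> \<le> heat x l" "heat x l \<le> psi 1 * sqrt l" "heat x l \<le> psi 1 * \<bar>x\<bar> + sqrt l"
proof -
  have q: "sqrt l > 0" using assms by simp
  note b = psi_bounds[OF sq_le_imp_abs_div_sqrt_le[OF assms], THEN mult_left_mono, of "sqrt l"]
  show "psi 1 * \<bar>x\<bar> \<le> heat x l" "heat x l \<le> psi 1 * sqrt l" "heat x l \<le> psi 1 * \<bar>x\<bar> + sqrt l"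
    using b q by (auto simp: heat_def abs_divide field_simps)
qed

lemma bell_ge_abs: "\<bar>x\<bar> \<le> bell x l"
proof (cases "l \<le> x\<^sup>2")
  case False
  then have "0 < l" using zero_le_power2[of x] by linarith
  with False show ?thesis using heat_bounds(1)[of l x] psi_pos[of 1]
    by (auto simp: bell_def field_simps)
qed (auto simp: bell_def)

lemma bell_ge: "x \<le> bell x l" "- x \<le> bell x l"
  using bell_ge_abs[of x l] by (auto simp: abs_le_iff)

lemma bell_le_sqrt:
  assumes "0 < l" "x\<^sup>2 \<le> l"
  shows "bell x l \<le> sqrt l"
  using heat_bounds(2)[OF assms] bell_eq_heat[OF assms] psi_pos[of 1]
  by (simp add: divide_le_eq mult.commute)

text \<open>The excess of \<open>bell\<close> over |x| is largest at x = 0, where it is the constant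
  on the right. This is the price charged to points whose square function has not reached the
  level.\<close>

lemma bell_le_abs_plus:
  assumes "0 \<le> l"
  shows "bell x l \<le> \<bar>x\<bar> + sqrt l / psi 1"
proof (cases "l \<le> x\<^sup>2")
  case False
  then have "0 < l" using zero_le_power2[of x] by linarith
  with False show ?thesis using heat_bounds(3)[of l x] psi_pos[of 1]
    by (auto simp: bell_def field_simps)
qed (use assms psi_pos[of 1] in \<open>auto simp: bell_def\<close>)

lemma bell_mono:
  assumes "0 < l" "\<bar>x\<bar> \<le> \<bar>y\<bar>" "y\<^sup>2 \<le> l"
  shows "bell x l \<le> bell y l"
proof -
  have "x\<^sup>2 \<le> y\<^sup>2" using assms by (simp add: abs_le_square_iff)
  then have "bell x l = heat x l / psi 1" "bell y l = heat y l / psi 1"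
    using assms by (auto intro!: bell_eq_heat)
  moreover have "heat x l \<le> heat y l"
    using assms psi_mono[of "x / sqrt l" "y / sqrt l"]
    by (auto simp: heat_def divide_right_mono)
  ultimately show ?thesis using psi_pos[of 1] by (simp add: divide_right_mono)
qed

text \<open>As s grows to a, the right point moves outward while the parabola at level l - s^2
  shrinks. The condition at s = a together with x \<ge> 0 therefore keeps [c - h, c + h] within
  [-1, 1] all along.\<close>

lemma heat_average_inside:
  assumes "0 \<le> x" "0 \<le> a" "0 < m" "x + a \<le> sqrt m"
  shows "2 * heat x (m + a\<^sup>2) \<le> heat (x + a) m + heat (x - a) m"
proof -
  let ?l = "m + a\<^sup>2"
  let ?g = "\<lambda>s. heat (x + s) (?l - s\<^sup>2) + heat (x - s) (?l - s\<^sup>2)"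
  have lt: "s\<^sup>2 < ?l" "x + s \<le> sqrt (?l - s\<^sup>2)" "0 < sqrt (?l - s\<^sup>2)" if "0 \<le> s" "s \<le> a" for s
  proof -
    have s: "s\<^sup>2 \<le> a\<^sup>2" using that by (simp add: power_mono)
    then show "s\<^sup>2 < ?l" "0 < sqrt (?l - s\<^sup>2)" using assms(3) by auto
    have "sqrt m \<le> sqrt (?l - s\<^sup>2)" using s by simp
    then show "x + s \<le> sqrt (?l - s\<^sup>2)" using that assms by linarith
  qed
  have "?g 0 \<le> ?g a"
  proof (rule deriv_nonneg_imp_le[OF assms(2) heat_pair_deriv])
    fix s assume s: "0 \<le> s" "s \<le> a"
    define q where "q = sqrt (?l - s\<^sup>2)"
    have q: "0 < q" "x + s \<le> q" using lt[OF s] by (auto simp: q_def)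
    have h: "0 \<le> s / q" "-1 \<le> x / q - s / q" "x / q + s / q \<le> 1"
      using q s assms by (auto simp: field_simps)
    show "0 \<le> (let c = x / sqrt (?l - s\<^sup>2); h = s / sqrt (?l - s\<^sup>2) in
      gauss_int (c + h) - gauss_int (c - h) - h * (exp (- ((c + h)\<^sup>2 / 2)) + exp (- ((c - h)\<^sup>2 / 2))))"
      using trapezoid_nonneg[OF h] by (simp add: Let_def q_def)
  qed (use lt in auto)
  then show ?thesis by simp
qed

text \<open>The right landing point \<open>y + 2 * a\<close> lies outside the parabola. Starting from the step at which it is on
  the boundary, enlarging the step with \<open>y\<close> fixed increases the left side at rate at most \<open>2 * psi 1\<close>.\<close>

lemma heat_average_exit:
  assumes "0 \<le> a" "0 < q" "\<bar>y\<bar> \<le> q" "q \<le> y + 2 * a" "y\<^sup>2 + 2 * y * a \<le> q\<^sup>2"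
  shows "2 * heat (y + a) (q\<^sup>2 + a\<^sup>2) \<le> heat y (q\<^sup>2) + psi 1 * (y + 2 * a)"
proof -
  \<comment> \<open>With step \<open>r0\<close> the right landing point is q, on the boundary, so
    the estimate for landing inside still applies.\<close>
  define r0 where "r0 = (q - y) / 2"
  have r0: "0 \<le> r0" "r0 \<le> a" "0 \<le> y + r0" "y + r0 + r0 = q" using assms by (auto simp: r0_def field_simps)
  let ?g = "\<lambda>r. psi 1 * r - heat (y + r) (q\<^sup>2 + r\<^sup>2)"
  have "?g r0 \<le> ?g a"
  proof (rule deriv_nonneg_imp_le[OF r0(2)])
    fix r assume r: "r0 \<le> r" "r \<le> a"
    define s where "s = sqrt (q\<^sup>2 + r\<^sup>2)"
    have p: "0 < q\<^sup>2 + r\<^sup>2" using assms by (simp add: add_pos_nonneg)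
    then have s: "s > 0" by (simp add: s_def)
    have d: "((\<lambda>r. y + r) has_real_derivative 1) (at r)" "((\<lambda>r. q\<^sup>2 + r\<^sup>2) has_real_derivative 2 * r) (at r)"
      by (auto intro!: derivative_eq_intros)
    show "(?g has_real_derivative psi 1 - (gauss_int ((y + r) / s) + exp (- (((y + r) / s)\<^sup>2 / 2)) * (r / s))) (at r)"
      by (rule DERIV_cong[OF DERIV_diff[OF DERIV_cmult[OF DERIV_ident] heat_deriv[OF d p]]])
        (simp add: s_def)
    \<comment> \<open>This says that the start (y + r, q^2 + r^2) stays inside the parabola, where
      the slope bound holds. It is linear in r: for y \<ge> 0 it is inherited from r = a, otherwise
      it follows from |y| \<le> q.\<close>
    have "y\<^sup>2 + 2 * y * r \<le> q\<^sup>2"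
    proof (cases "y \<ge> 0")
      case True
      then show ?thesis using mult_left_mono[OF r(2) True] assms(5) by linarith
    next
      case False
      have "y\<^sup>2 \<le> q\<^sup>2" using assms by (simp add: abs_le_square_iff[symmetric])
      moreover have "y * r \<le> 0" using False r r0 by (simp add: mult_nonpos_nonneg)
      ultimately show ?thesis by linarith
    qed
    then have "(y + r)\<^sup>2 \<le> q\<^sup>2 + r\<^sup>2" by (simp add: power2_eq_square algebra_simps)
    then have t: "(y + r) / s \<le> 1"
      using sq_le_imp_abs_div_sqrt_le[OF p, of "y + r"] by (metis s_def abs_le_D1)
    have "r / s \<le> 1" using s by (simp add: s_def real_le_rsqrt)
    then have "exp (- (((y + r) / s)\<^sup>2 / 2)) * (r / s) \<le> exp (- (((y + r) / s)\<^sup>2 / 2)) * 1"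
      by (intro mult_left_mono) auto
    then show "0 \<le> psi 1 - (gauss_int ((y + r) / s) + exp (- (((y + r) / s)\<^sup>2 / 2)) * (r / s))"
      using gauss_int_le_psi_1[OF t] by linarith
  qed
  moreover have "2 * heat (y + r0) (q\<^sup>2 + r0\<^sup>2) \<le> psi 1 * q + heat y (q\<^sup>2)"
    using heat_average_inside[of "y + r0" r0 "q\<^sup>2"] r0 assms heat_boundary[of q] by auto
  moreover have "psi 1 * q = psi 1 * (y + 2 * r0)" using r0(4) by (simp add: algebra_simps)
  ultimately show ?thesis by (simp add: algebra_simps)
qed

text \<open>For a start outside the parabola convexity of |x| suffices. For one inside, the cases
  are whether any level remains after the split and which landing points lie in [-q, q].\<close>

lemma bell_average_nonneg:
  assumes "0 \<le> x" "0 \<le> a"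
  shows "bell x l \<le> (bell (x + a) (l - a\<^sup>2) + bell (x - a) (l - a\<^sup>2)) / 2"
proof (cases "l \<le> x\<^sup>2")
  case True
  then have "bell x l = x" using assms by (simp add: bell_def)
  moreover have "x \<le> (bell (x + a) (l - a\<^sup>2) + bell (x - a) (l - a\<^sup>2)) / 2"
    using bell_ge(1)[of "x + a" "l - a\<^sup>2"] bell_ge(1)[of "x - a" "l - a\<^sup>2"] by simp
  ultimately show ?thesis by simp
next
  case inside: False
  then have l: "0 < l" "x\<^sup>2 \<le> l" by (smt (verit) zero_le_power2)+
  note P = psi_pos[of 1]
  show ?thesis
  proof (cases "l \<le> a\<^sup>2")
    case True
    \<comment> \<open>The level is used up. The mean absolute landing value is at least a, hence at
      least sqrt l, which \<open>bell\<close> never exceeds inside the parabola.\<close>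
    then have "sqrt l \<le> a" using assms by (simp add: real_le_lsqrt)
    then have "bell x l \<le> a" using bell_le_sqrt[OF l] by linarith
    then show ?thesis
      using bell_ge(1)[of "x + a" "l - a\<^sup>2"] bell_ge(2)[of "x - a" "l - a\<^sup>2"] by simp
  next
    case False
    define q where "q = sqrt (l - a\<^sup>2)"
    have q: "0 < q" "l - a\<^sup>2 = q\<^sup>2" "l = q\<^sup>2 + a\<^sup>2" using False by (auto simp: q_def)
    have sq: "y\<^sup>2 \<le> q\<^sup>2 \<longleftrightarrow> \<bar>y\<bar> \<le> q" for y using q abs_le_square_iff[of y q] by simp
    have eq: "bell y (q\<^sup>2) = heat y (q\<^sup>2) / psi 1" if "\<bar>y\<bar> \<le> q" for y
      using that q sq by (intro bell_eq_heat) auto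
    \<comment> \<open>Stated for a general start z because the case with both landing points outside
      is reduced to z = a - q.\<close>
    have exit: "bell z l \<le> (z + a + bell (z - a) (q\<^sup>2)) / 2"
      if z: "z\<^sup>2 \<le> l" "\<bar>z - a\<bar> \<le> q" "q \<le> z + a" for z
    proof -
      have "(z - a)\<^sup>2 + 2 * (z - a) * a \<le> q\<^sup>2"
        using z(1) unfolding q(3) by (simp add: power2_eq_square algebra_simps)
      from heat_average_exit[OF assms(2) q(1) z(2) _ this] z(3)
      have "2 * heat z l \<le> heat (z - a) (q\<^sup>2) + psi 1 * (z + a)"
        by (simp add: q(3) algebra_simps)
      then have "psi 1 * (2 * bell z l) \<le> psi 1 * (z + a + bell (z - a) (q\<^sup>2))"
        using P bell_eq_heat[OF l(1) z(1)] eq[OF z(2)] by (simp add: field_simps)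
      then show ?thesis using P by simp
    qed
    consider "x + a \<le> q" | "q < x + a" "\<bar>x - a\<bar> \<le> q" | "x - a < - q" | "q < x - a" by linarith
    then show ?thesis
    proof cases
      case 1
      then have b: "\<bar>x + a\<bar> \<le> q" "\<bar>x - a\<bar> \<le> q" using assms by auto
      have "2 * heat x l \<le> heat (x + a) (q\<^sup>2) + heat (x - a) (q\<^sup>2)"
        using heat_average_inside[OF assms, of "q\<^sup>2"] 1 q by simp
      then have "psi 1 * (2 * bell x l) \<le> psi 1 * (bell (x + a) (q\<^sup>2) + bell (x - a) (q\<^sup>2))"
        using P eq[OF b(1)] eq[OF b(2)] bell_eq_heat[OF l] by (simp add: distrib_left)
      then show ?thesis using P q(2) by simp
    next
      case 2
      then show ?thesis using exit[OF l(2)] bell_ge_abs[of "x + a" "q\<^sup>2"] assms q(2) by simp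
    next
      \<comment> \<open>Both landing points are outside. Moving the start outward to a - q, whose
        left landing point is the boundary point -q, can only raise \<open>bell\<close>, and there
        the exit estimate gives a.\<close>
      case 3
      then have z: "0 \<le> a - q" "x \<le> a - q" using assms by auto
      have "(a - q)\<^sup>2 \<le> l" using z q mult_nonneg_nonneg[of q a] assms by (simp add: power2_eq_square algebra_simps)
      then have "bell x l \<le> bell (a - q) l" "bell (a - q) l \<le> (a - q + a + bell (- q) (q\<^sup>2)) / 2"
        using bell_mono[OF l(1), of x "a - q"] exit[of "a - q"] z assms 3 q by auto
      moreover have "bell (- q) (q\<^sup>2) = q" using q by (simp add: bell_def)
      ultimately have "bell x l \<le> a" by simp
      then show ?thesis
        using bell_ge(1)[of "x + a" "l - a\<^sup>2"] bell_ge(2)[of "x - a" "l - a\<^sup>2"] by simp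
    next
      case 4
      then have "(q + a)\<^sup>2 \<le> x\<^sup>2" using q assms by (intro power_mono) auto
      moreover have "(q + a)\<^sup>2 = l + 2 * (q * a)" by (simp add: q(3) power2_eq_square algebra_simps)
      moreover have "0 \<le> q * a" using q assms by simp
      ultimately show ?thesis using inside by linarith
    qed
  qed
qed

lemma bell_average:
  "bell x l \<le> (bell (x + a) (l - a\<^sup>2) + bell (x - a) (l - a\<^sup>2)) / 2"
proof -
  have 1: "bell x l \<le> (bell (x + a) (l - a\<^sup>2) + bell (x - a) (l - a\<^sup>2)) / 2" if "0 \<le> x" for x
    using bell_average_nonneg[OF that, of "\<bar>a\<bar>" l] by (cases "a \<ge> 0") (auto simp: add.commute)
  show ?thesis
    using 1[of x] 1[of "- x"] bell_minus[of "x + a" "l - a\<^sup>2"] bell_minus[of "x - a" "l - a\<^sup>2"]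
    by (cases "0 \<le> x") (simp_all add: algebra_simps bell_minus[of "x + a", simplified])
qed

section \<open>Near-optimal finite splittings\<close>

text \<open>With 1 - s^2 \<ge> 1/2 the trapezoidal error is at most 2 s^2, below the derivative 3
  s^2 of s^3. The loss per split is cubic in the step, while the level falls quadratically.\<close>

lemma heat_average_upper:
  assumes "0 \<le> a" "a\<^sup>2 \<le> 1 / 2"
  shows "heat (x + a) (1 - a\<^sup>2) + heat (x - a) (1 - a\<^sup>2) \<le> 2 * psi x + a ^ 3"
proof -
  let ?D = "\<lambda>s. let c = x / sqrt (1 - s\<^sup>2); h = s / sqrt (1 - s\<^sup>2) in
      gauss_int (c + h) - gauss_int (c - h) - h * (exp (- ((c + h)\<^sup>2 / 2)) + exp (- ((c - h)\<^sup>2 / 2)))"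
  let ?g = "\<lambda>s. s ^ 3 - (heat (x + s) (1 - s\<^sup>2) + heat (x - s) (1 - s\<^sup>2))"
  have "?g 0 \<le> ?g a"
  proof (rule deriv_nonneg_imp_le[OF assms(1)])
    fix s assume s: "0 \<le> s" "s \<le> a"
    then have s2: "s\<^sup>2 \<le> 1 / 2" using assms power_mono[of s a 2] by linarith
    have p: "((\<lambda>s. s ^ 3) has_real_derivative 3 * s\<^sup>2) (at s)"
      by (auto intro!: derivative_eq_intros)
    show "(?g has_real_derivative 3 * s\<^sup>2 - ?D s) (at s)"
      by (rule DERIV_diff[OF p heat_pair_deriv]) (use s2 in auto)
    have "?D s \<le> (s / sqrt (1 - s\<^sup>2))\<^sup>2"
      unfolding Let_def by (rule trapezoid_upper) (use s s2 in auto)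
    also have "\<dots> = s\<^sup>2 / (1 - s\<^sup>2)" using s2 by (simp add: power_divide)
    also have "\<dots> \<le> s\<^sup>2 / (1 / 2)" using s2 by (intro divide_left_mono) auto
    finally have "?D s \<le> 2 * s\<^sup>2" by simp
    then show "0 \<le> 3 * s\<^sup>2 - ?D s" using zero_le_power2[of s] by linarith
  qed
  moreover have "heat x 1 = psi x" by (simp add: heat_def)
  ultimately show ?thesis by simp
qed

text \<open>\<open>reach x l e\<close>: some finite dyadic martingale starting at \<open>x\<close> has squared square function at
  least \<open>l\<close> everywhere and mean absolute final value \<open>e\<close>.\<close>

inductive reach :: "real \<Rightarrow> real \<Rightarrow> real \<Rightarrow> bool" where
  stop: "l \<le> 0 \<Longrightarrow> reach x l \<bar>x\<bar>"
| split: "reach (x - d) (l - d\<^sup>2) e1 \<Longrightarrow> reach (x + d) (l - d\<^sup>2) e2 \<Longrightarrow> reach x l ((e1 + e2) / 2)"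

lemma reach_one_split:
  assumes "0 \<le> l"
  shows "reach x l ((\<bar>x - sqrt l\<bar> + \<bar>x + sqrt l\<bar>) / 2)"
  using assms by (intro reach.split[where d = "sqrt l"] reach.stop) auto

text \<open>A jump of sqrt l \<le> |x| uses up the level without crossing 0, so the mean absolute
  value does not grow. This is why the candidate is |x| outside the parabola.\<close>

lemma reach_outside:
  assumes "l \<le> x\<^sup>2"
  shows "reach x l \<bar>x\<bar>"
proof (cases "l \<le> 0")
  case False
  then have "sqrt l \<le> \<bar>x\<bar>" using assms real_sqrt_le_iff[of l "x\<^sup>2"] by simp
  moreover have "\<bar>x - s\<bar> + \<bar>x + s\<bar> = 2 * \<bar>x\<bar>" if "0 \<le> s" "s \<le> \<bar>x\<bar>" for s
    using that by linarith
  ultimately have "\<bar>x - sqrt l\<bar> + \<bar>x + sqrt l\<bar> = 2 * \<bar>x\<bar>" using False by simp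
  then show ?thesis using reach_one_split[of l x] False by simp
qed (rule reach.stop)

text \<open>The candidate plus a slack: sqrt l drops at every split, and the slack released pays for
  the discretisation error. The heat formula is kept outside the parabola, so that it stays smooth
  across the boundary.\<close>

definition barrier :: "real \<Rightarrow> real \<Rightarrow> real \<Rightarrow> real" where
  "barrier \<epsilon> x l = heat x l / psi 1 + \<epsilon> * sqrt l"

lemma barrier_scale: "t > 0 \<Longrightarrow> barrier \<epsilon> (t * x) (t\<^sup>2 * l) = t * barrier \<epsilon> x l"
  using heat_scale[of t x l] by (simp add: barrier_def real_sqrt_mult distrib_left)

lemma barrier_ge:
  assumes "0 \<le> \<epsilon>" "0 \<le> l"
  shows "sqrt l / psi 1 \<le> barrier \<epsilon> x l"
  using mult_left_mono[OF psi_ge_1[of "x / sqrt l"], of "sqrt l"] assms psi_pos[of 1]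
  by (auto simp: barrier_def heat_def intro!: add_increasing2 divide_right_mono)

text \<open>Beyond the boundary \<open>heat y l / psi 1\<close> need not dominate |y|, but it is at
  least its boundary value sqrt (1 - a^2). An overshoot to at most 1 + a is covered by the
  slack.\<close>

lemma barrier_exit:
  assumes "0 < a" "a \<le> 1 / 4" "1 - a\<^sup>2 \<le> y\<^sup>2" "\<bar>y\<bar> \<le> 1 + a"
  shows "\<bar>y\<bar> \<le> barrier (4 * a) y (1 - a\<^sup>2)"
proof -
  have a2: "a\<^sup>2 \<le> 1 / 16" using power_mono[OF assms(2), of 2] assms by (simp add: power2_eq_square)
  then have m: "0 < sqrt (1 - a\<^sup>2)" by simp
  have "sqrt (1 - a\<^sup>2) \<le> \<bar>y\<bar>" using assms(3) real_sqrt_le_iff[of "1 - a\<^sup>2" "y\<^sup>2"] by simp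
  then have "psi 1 \<le> psi (y / sqrt (1 - a\<^sup>2))" using m by (intro psi_mono) auto
  then have "sqrt (1 - a\<^sup>2) \<le> heat y (1 - a\<^sup>2) / psi 1"
    using m psi_pos[of 1] by (simp add: heat_def field_simps)
  then have "(1 + 4 * a) * sqrt (1 - a\<^sup>2) \<le> barrier (4 * a) y (1 - a\<^sup>2)"
    by (simp add: barrier_def algebra_simps)
  moreover have "1 + a \<le> (1 + 4 * a) * sqrt (1 - a\<^sup>2)"
  proof -
    \<comment> \<open>(1 + 4a)^2 (1 - a^2) - (1 + a)^2 factors as (1 + a)(6a + 8a^2 -
      16a^3).\<close>
    have "a * a\<^sup>2 \<le> a * 1" using assms a2 by (intro mult_left_mono) auto
    then have "0 \<le> 6 * a + 8 * a\<^sup>2 - 16 * (a * a\<^sup>2)"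
      using mult_left_mono[OF a2, of a] zero_le_power2[of a] assms(1) by linarith
    then have "0 \<le> (1 + a) * (6 * a + 8 * a\<^sup>2 - 16 * (a * a\<^sup>2))" using assms by simp
    then have "(1 + a)\<^sup>2 \<le> (1 + 4 * a)\<^sup>2 * (1 - a\<^sup>2)"
      by (simp add: power2_eq_square algebra_simps)
    then have "1 + a \<le> sqrt ((1 + 4 * a)\<^sup>2 * (1 - a\<^sup>2))" by (rule real_le_rsqrt)
    also have "\<dots> = (1 + 4 * a) * sqrt (1 - a\<^sup>2)" using assms by (simp add: real_sqrt_mult)
    finally show ?thesis .
  qed
  ultimately show ?thesis using assms(4) by linarith
qed

text \<open>The split loses at most a^3 / 2, while the slack releases at least 2 a^3 because sqrt (1
  - a^2) \<le> 1 - a^2 / 2. The surplus is at least a^3; as the barrier is at most 2, this is a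
  factor 1 - a^3 / 2.\<close>

lemma barrier_average:
  assumes "0 < a" "a \<le> 1 / 4" "\<bar>x\<bar> \<le> 1"
  shows "(barrier (4 * a) (x - a) (1 - a\<^sup>2) + barrier (4 * a) (x + a) (1 - a\<^sup>2)) / 2
     \<le> (1 - a ^ 3 / 2) * barrier (4 * a) x 1"
proof -
  have a2: "a\<^sup>2 \<le> 1 / 2" using power_mono[OF assms(2), of 2] assms by (simp add: power2_eq_square)
  have P: "1 \<le> psi 1" by (rule psi_ge_1)
  let ?s = "sqrt (1 - a\<^sup>2)"
  have s: "?s \<le> 1 - a\<^sup>2 / 2"
    using a2 zero_le_power2[of "a\<^sup>2"] by (intro real_le_lsqrt) (auto simp: power2_diff power_divide)
  have b: "barrier (4 * a) x 1 \<le> 2"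
  proof -
    have "psi x \<le> psi 1" using psi_bounds(2)[OF assms(3)] .
    then have "heat x 1 / psi 1 \<le> 1" using P by (simp add: heat_def)
    then show ?thesis using assms by (simp add: barrier_def)
  qed
  have "(heat (x + a) (1 - a\<^sup>2) + heat (x - a) (1 - a\<^sup>2)) / psi 1 \<le> (2 * psi x + a ^ 3) / psi 1"
    using heat_average_upper[of a x] assms a2 P by (intro divide_right_mono) auto
  also have "\<dots> \<le> 2 * (psi x / psi 1) + a ^ 3"
    using P assms by (simp add: add_divide_distrib divide_le_eq)
  finally have 1: "(heat (x + a) (1 - a\<^sup>2) + heat (x - a) (1 - a\<^sup>2)) / psi 1 \<le> 2 * (psi x / psi 1) + a ^ 3" .
  have 2: "a * ?s \<le> a - a ^ 3 / 2"
    using mult_left_mono[OF s, of a] assms by (simp add: power2_eq_square power3_eq_cube algebra_simps)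
  have "(barrier (4 * a) (x - a) (1 - a\<^sup>2) + barrier (4 * a) (x + a) (1 - a\<^sup>2)) / 2
      = (heat (x + a) (1 - a\<^sup>2) + heat (x - a) (1 - a\<^sup>2)) / psi 1 / 2 + 4 * (a * ?s)"
    by (simp add: barrier_def add_divide_distrib)
  also have "\<dots> \<le> psi x / psi 1 + a ^ 3 / 2 + 4 * (a - a ^ 3 / 2)"
    using 1 2 by argo
  also have "\<dots> \<le> barrier (4 * a) x 1 - a ^ 3"
    using assms by (simp add: barrier_def heat_def)
  also have "\<dots> \<le> (1 - a ^ 3 / 2) * barrier (4 * a) x 1"
    using mult_left_mono[OF b, of "a ^ 3 / 2"] assms by (simp add: algebra_simps)
  finally show ?thesis .
qed

text \<open>The constant starts at a crude value and contracts geometrically until it reaches 1.\<close>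

lemma reach_iterate:
  assumes a: "0 < a" "a \<le> 1 / 4" and l: "0 < l" "x\<^sup>2 \<le> l"
  shows "\<exists>e. reach x l e \<and> e \<le> max 1 (2 * psi 1 * (1 - a ^ 3 / 2) ^ n) * barrier (4 * a) x l"
  using l
proof (induction n arbitrary: x l)
  case 0
  \<comment> \<open>Finishing by one jump costs at most 2 sqrt l, and the barrier is at least sqrt l
    / psi 1; hence the starting constant \<open>2 * psi 1\<close>.\<close>
  let ?e = "(\<bar>x - sqrt l\<bar> + \<bar>x + sqrt l\<bar>) / 2"
  have Z: "0 \<le> sqrt l" using 0 by simp
  have "\<bar>x\<bar> \<le> sqrt l" using 0 by (simp add: real_le_rsqrt)
  then have "?e \<le> 2 * sqrt l" using Z by (auto simp: abs_if)
  also have "\<dots> \<le> 2 * psi 1 * barrier (4 * a) x l"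
    using mult_left_mono[OF barrier_ge[of "4 * a" l x], of "2 * psi 1"] a 0 psi_pos[of 1] by simp
  also have "\<dots> \<le> max 1 (2 * psi 1) * barrier (4 * a) x l"
    using barrier_ge[of "4 * a" l x] a 0 psi_pos[of 1]
    by (intro mult_right_mono) (auto intro: order_trans[rotated])
  finally show ?case using reach_one_split[of l x] 0 by auto
next
  case (Suc n)
  define s where "s = sqrt l"
  define \<xi> where "\<xi> = x / s"
  define c where "c = max 1 (2 * psi 1 * (1 - a ^ 3 / 2) ^ n)"
  have s: "0 < s" "l = s\<^sup>2" "x = s * \<xi>" using Suc.prems by (auto simp: s_def \<xi>_def)
  have \<xi>: "\<bar>\<xi>\<bar> \<le> 1"
    using sq_le_imp_abs_div_sqrt_le[OF Suc.prems] by (simp add: \<xi>_def s_def)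
  have c: "1 \<le> c" by (simp add: c_def)
  have a2: "a\<^sup>2 \<le> 1 / 16" using power_mono[OF a(2), of 2] a by (simp add: power2_eq_square)
  \<comment> \<open>After scaling to level 1, a landing point inside the parabola is left to the
    induction hypothesis. One outside is finished at cost \<open>\<bar>s * y\<bar>\<close>, which
    the barrier dominates with constant 1; hence the maximum with 1.\<close>
  have step: "\<exists>e. reach (s * y) (s\<^sup>2 * (1 - a\<^sup>2)) e \<and> e \<le> c * (s * barrier (4 * a) y (1 - a\<^sup>2))"
    if "\<bar>y\<bar> \<le> 1 + a" for y
  proof (cases "(s * y)\<^sup>2 \<le> s\<^sup>2 * (1 - a\<^sup>2)")
    case True
    have "0 < s\<^sup>2 * (1 - a\<^sup>2)" using s a2 by simp
    from Suc.IH[OF this True] show ?thesis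
      using s by (simp add: barrier_scale c_def)
  next
    case False
    then have out: "s\<^sup>2 * (1 - a\<^sup>2) \<le> s\<^sup>2 * y\<^sup>2" by (simp add: power_mult_distrib)
    then have "1 - a\<^sup>2 \<le> y\<^sup>2" using s by simp
    from barrier_exit[OF a this that] have b: "\<bar>y\<bar> \<le> barrier (4 * a) y (1 - a\<^sup>2)" .
    then have "\<bar>s * y\<bar> \<le> s * barrier (4 * a) y (1 - a\<^sup>2)" using s by (simp add: abs_mult)
    also have "\<dots> = 1 * (s * barrier (4 * a) y (1 - a\<^sup>2))" by simp
    also have "\<dots> \<le> c * (s * barrier (4 * a) y (1 - a\<^sup>2))"
      using c s b by (intro mult_right_mono) auto
    finally show ?thesis using reach_outside[of "s\<^sup>2 * (1 - a\<^sup>2)" "s * y"] out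
      by (auto simp: power_mult_distrib)
  qed
  have ya: "\<bar>\<xi> - a\<bar> \<le> 1 + a" "\<bar>\<xi> + a\<bar> \<le> 1 + a" using \<xi> a by linarith+
  obtain e1 where e1: "reach (s * (\<xi> - a)) (s\<^sup>2 * (1 - a\<^sup>2)) e1" "e1 \<le> c * (s * barrier (4 * a) (\<xi> - a) (1 - a\<^sup>2))"
    using step[of "\<xi> - a"] ya by auto
  obtain e2 where e2: "reach (s * (\<xi> + a)) (s\<^sup>2 * (1 - a\<^sup>2)) e2" "e2 \<le> c * (s * barrier (4 * a) (\<xi> + a) (1 - a\<^sup>2))"
    using step[of "\<xi> + a"] ya by auto
  have r: "reach x l ((e1 + e2) / 2)"
    by (rule reach.split[where d = "s * a"])
      (use e1 e2 in \<open>auto simp: s(2,3) algebra_simps power_mult_distrib\<close>)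
  have B: "0 \<le> barrier (4 * a) x l"
    using barrier_ge[of "4 * a" l x] a Suc.prems psi_pos[of 1] by (auto intro: order_trans[rotated])
  have a3: "a ^ 3 \<le> 1" using a by (intro power_le_one) auto
  have "(e1 + e2) / 2 \<le> c * s * ((barrier (4 * a) (\<xi> - a) (1 - a\<^sup>2) + barrier (4 * a) (\<xi> + a) (1 - a\<^sup>2)) / 2)"
    using e1(2) e2(2) by (simp add: algebra_simps)
  also have "\<dots> \<le> c * s * ((1 - a ^ 3 / 2) * barrier (4 * a) \<xi> 1)"
    using c s by (intro mult_left_mono barrier_average a \<xi>) auto
  also have "\<dots> = c * (1 - a ^ 3 / 2) * barrier (4 * a) x l"
    using barrier_scale[OF s(1), of "4 * a" \<xi> 1] s by simp
  also have "\<dots> \<le> max 1 (2 * psi 1 * (1 - a ^ 3 / 2) ^ Suc n) * barrier (4 * a) x l"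
  proof (rule mult_right_mono[OF _ B])
    show "c * (1 - a ^ 3 / 2) \<le> max 1 (2 * psi 1 * (1 - a ^ 3 / 2) ^ Suc n)"
    proof (cases "2 * psi 1 * (1 - a ^ 3 / 2) ^ n \<le> 1")
      case True
      then have "c * (1 - a ^ 3 / 2) \<le> 1" using a by (simp add: c_def)
      then show ?thesis by simp
    next
      case False
      then have e: "c * (1 - a ^ 3 / 2) = 2 * psi 1 * (1 - a ^ 3 / 2) ^ Suc n"
        by (simp add: c_def max_def)
      show ?thesis unfolding e by (rule max.cobounded2)
    qed
  qed
  finally show ?case using r by blast
qed

lemma reach_near_optimal:
  assumes "0 < l" "0 < \<eta>"
  shows "\<exists>e. reach 0 l e \<and> e \<le> sqrt l / psi 1 + \<eta>"
proof -
  \<comment> \<open>The choice of a makes the slack \<open>4 * a * sqrt l\<close> at most \<eta>.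
    With a fixed, n is taken so large that the crude constant falls below 1.\<close>
  define a where "a = min (1 / 4) (\<eta> / (4 * sqrt l))"
  have a: "0 < a" "a \<le> 1 / 4" using assms by (auto simp: a_def)
  have "a \<le> \<eta> / (4 * sqrt l)" by (simp add: a_def)
  then have al: "4 * a * sqrt l \<le> \<eta>" using assms by (simp add: field_simps)
  have a3: "0 \<le> 1 - a ^ 3 / 2" "1 - a ^ 3 / 2 < 1" 
    using power_le_one[of a 3] a by auto
  have "(\<lambda>n. 2 * psi 1 * (1 - a ^ 3 / 2) ^ n) \<longlonglongrightarrow> 2 * psi 1 * 0"
    using a3 by (intro tendsto_mult_left LIMSEQ_power_zero) auto
  then have "\<forall>\<^sub>F n in sequentially. 2 * psi 1 * (1 - a ^ 3 / 2) ^ n < 1"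
    by (intro order_tendstoD(2)) auto
  then obtain n where "2 * psi 1 * (1 - a ^ 3 / 2) ^ n < 1"
    by (auto simp: eventually_sequentially)
  then have "\<exists>e. reach 0 l e \<and> e \<le> barrier (4 * a) 0 l"
    using reach_iterate[OF a assms(1), of 0 n] assms by (simp add: max_def)
  moreover have "barrier (4 * a) 0 l \<le> sqrt l / psi 1 + \<eta>"
    using al by (simp add: barrier_def heat_def)
  ultimately show ?thesis by force
qed

section \<open>Dyadic cells and the square function\<close>

definition cell :: "int \<Rightarrow> int \<Rightarrow> real set" where
  "cell n k = {of_int k * 2 powi n ..< of_int (k + 1) * 2 powi n}"

definition cell_index :: "int \<Rightarrow> real \<Rightarrow> int" where
  "cell_index n x = \<lfloor>x / 2 powi n\<rfloor>"

text \<open>Its absolute value is the constant value of |Delta_I| on the cell; the sign is kept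
  because it tells which half has the larger average.\<close>

definition jump :: "int \<Rightarrow> int \<Rightarrow> (real \<Rightarrow> real) \<Rightarrow> real" where
  "jump n k \<phi> = (avg (cell (n - 1) (2 * k + 1)) \<phi> - avg (cell (n - 1) (2 * k)) \<phi>) / 2"

lemma dyadic_iff: "I \<in> dyadic \<longleftrightarrow> (\<exists>n k. I = cell n k)"
  by (auto simp: dyadic_def cell_def)

lemma powi_2_pos [simp]: "(0::real) < 2 powi n"
  by simp

lemma powi_2_pred: "(2::real) powi n = 2 * 2 powi (n - 1)"
  using power_int_add[of "2::real" 1 "n - 1"] by simp

lemma powi_2_le_iff: "(2::real) powi m \<le> 2 powi n \<longleftrightarrow> m \<le> n"
  using power_int_strict_increasing[of n m "2::real"] power_int_increasing[of m n "2::real"] by force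

lemma mem_cell_iff: "x \<in> cell n k \<longleftrightarrow> cell_index n x = k"
  by (auto simp: cell_def cell_index_def floor_eq_iff field_simps)

lemma cell_bounds: "of_int k * (2::real) powi n < of_int (k + 1) * 2 powi n"
  by (simp add: mult_strict_right_mono)

lemma Inf_cell: "Inf (cell n k) = of_int k * 2 powi n"
  and Sup_cell: "Sup (cell n k) = of_int (k + 1) * 2 powi n"
  unfolding cell_def using cell_bounds by (auto intro: cInf_atLeastLessThan cSup_atLeastLessThan)

lemma measure_cell [simp]: "measure lebesgue (cell n k) = 2 powi n"
  using cell_bounds[of k n] by (simp add: cell_def less_imp_le algebra_simps)

lemma emeasure_cell: "emeasure lebesgue (cell n k) = ennreal (2 powi n)"
  using cell_bounds[of k n] by (simp add: cell_def less_imp_le algebra_simps)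

lemma sets_cell [measurable, simp]: "cell n k \<in> sets lebesgue"
  by (simp add: cell_def)

lemma lmeasurable_cell [simp]: "cell n k \<in> lmeasurable"
  by (intro fmeasurableI) (auto simp: emeasure_cell)

lemma cell_inject [simp]: "cell n k = cell m j \<longleftrightarrow> n = m \<and> k = j"
proof
  assume eq: "cell n k = cell m j"
  then have "(2::real) powi n = 2 powi m" by (metis measure_cell)
  then have "n = m" by (metis powi_2_le_iff order_antisym order_refl)
  moreover have "real_of_int k * 2 powi n = of_int j * 2 powi m" using eq by (metis Inf_cell)
  ultimately show "n = m \<and> k = j" by simp
qed simp

lemma left_half_cell: "left_half (cell n k) = cell (n - 1) (2 * k)"
  and right_half_cell: "right_half (cell n k) = cell (n - 1) (2 * k + 1)"
  unfolding left_half_def right_half_def Inf_cell Sup_cell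
  by (auto simp: cell_def powi_2_pred[of n] algebra_simps)

lemma cell_index_cases:
  "cell_index (n - 1) x = 2 * cell_index n x \<or> cell_index (n - 1) x = 2 * cell_index n x + 1"
proof -
  have "cell_index n x = \<lfloor>x / 2 powi (n - 1) / real_of_int 2\<rfloor>"
    by (simp add: cell_index_def powi_2_pred[of n] mult.commute)
  also have "\<dots> = cell_index (n - 1) x div 2"
    unfolding cell_index_def by (rule floor_divide_real_eq_div) simp
  finally show ?thesis by presburger
qed

lemma cell_index_div: "cell_index n x = cell_index (n - 1) x div 2"
  using cell_index_cases[of n x] by presburger

lemma cell_split: "cell n k = cell (n - 1) (2 * k) \<union> cell (n - 1) (2 * k + 1)"
proof (rule set_eqI)
  fix x
  show "x \<in> cell n k \<longleftrightarrow> x \<in> cell (n - 1) (2 * k) \<union> cell (n - 1) (2 * k + 1)"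
    unfolding Un_iff mem_cell_iff using cell_index_div[of n x] by presburger
qed

lemma cell_halves_disjoint: "cell n (2 * k) \<inter> cell n (2 * k + 1) = {}"
  by (auto simp: mem_cell_iff)

lemma cell_chain_subset: "cell (n - int i) (cell_index (n - int i) x) \<subseteq> cell n (cell_index n x)"
proof (induction i)
  case (Suc i)
  define m where "m = n - int i"
  have e: "n - int (Suc i) = m - 1" by (simp add: m_def)
  have "cell (m - 1) (cell_index (m - 1) x) \<subseteq> cell m (cell_index m x)"
    by (intro subsetI) (metis mem_cell_iff cell_index_div)
  then show ?case using Suc unfolding e m_def by blast
qed simp

lemma cell_subset_imp_le:
  assumes "cell m j \<subseteq> cell n k"
  shows "m \<le> n"
proof -
  have "(2::real) powi m \<le> 2 powi n"
    using measure_mono_fmeasurable[OF assms sets_cell lmeasurable_cell] by simp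
  then show ?thesis by (simp add: powi_2_le_iff)
qed

text \<open>The dyadic subintervals through x form a chain with one member per generation, so the
  unordered sum in \<open>sq_fun2\<close> becomes a series.\<close>

lemma cells_below_containing:
  assumes "x \<in> cell n k"
  shows "{I \<in> dyadic. I \<subseteq> cell n k \<and> x \<in> I} = range (\<lambda>i. cell (n - int i) (cell_index (n - int i) x))"
proof (intro set_eqI iffI)
  fix I assume "I \<in> {I \<in> dyadic. I \<subseteq> cell n k \<and> x \<in> I}"
  then obtain m j where I: "I = cell m j" "cell m j \<subseteq> cell n k" "cell_index m x = j"
    by (auto simp: dyadic_iff mem_cell_iff)
  then have m: "n - int (nat (n - m)) = m" using cell_subset_imp_le[OF I(2)] by simp
  show "I \<in> range (\<lambda>i. cell (n - int i) (cell_index (n - int i) x))"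
    by (rule range_eqI[of _ _ "nat (n - m)"]) (simp only: m I)
next
  fix I assume "I \<in> range (\<lambda>i. cell (n - int i) (cell_index (n - int i) x))"
  then obtain i where I: "I = cell (n - int i) (cell_index (n - int i) x)" by auto
  moreover have "I \<subseteq> cell n k" using cell_chain_subset[of n i x] assms I by (simp add: mem_cell_iff)
  ultimately show "I \<in> {I \<in> dyadic. I \<subseteq> cell n k \<and> x \<in> I}"
    by (auto simp: dyadic_iff mem_cell_iff)
qed

lemma mart_diff_cell:
  assumes "x \<in> cell n k"
  shows "(mart_diff (cell n k) \<phi> x)\<^sup>2 = (jump n k \<phi>)\<^sup>2"
proof -
  have "x \<in> cell (n - 1) (2 * k) \<and> x \<notin> cell (n - 1) (2 * k + 1) \<or>
        x \<notin> cell (n - 1) (2 * k) \<and> x \<in> cell (n - 1) (2 * k + 1)"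
    using assms cell_split[of n k] cell_halves_disjoint by blast
  then show ?thesis
    by (auto simp: mart_diff_def left_half_cell right_half_cell jump_def power2_eq_square)
qed

lemma sq_fun2_suminf:
  assumes "x \<in> cell n k"
  shows "sq_fun2 (cell n k) \<phi> x =
    (\<Sum>i. ennreal ((jump (n - int i) (cell_index (n - int i) x) \<phi>)\<^sup>2))"
proof -
  let ?c = "\<lambda>i. cell (n - int i) (cell_index (n - int i) x)"
  let ?f = "\<lambda>I. ennreal (\<bar>mart_diff I \<phi> x\<bar>\<^sup>2 * indicator I x)"
  have "sq_fun2 (cell n k) \<phi> x = infsum ?f {I \<in> dyadic. I \<subseteq> cell n k \<and> x \<in> I}"
    unfolding sq_fun2_def by (rule infsum_cong_neutral) auto
  also have "\<dots> = infsum ?f (range ?c)"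
    by (simp add: cells_below_containing[OF assms])
  also have "\<dots> = infsum (?f \<circ> ?c) UNIV"
    by (rule infsum_reindex) (auto simp: inj_on_def)
  also have "?f \<circ> ?c = (\<lambda>i. ennreal ((jump (n - int i) (cell_index (n - int i) x) \<phi>)\<^sup>2))"
    by (simp add: fun_eq_iff mem_cell_iff mart_diff_cell)
  also have "infsum \<dots> UNIV = (\<Sum>i. ennreal ((jump (n - int i) (cell_index (n - int i) x) \<phi>)\<^sup>2))"
    by (intro sums_unique has_sum_imp_sums has_sum_infsum nonneg_summable_on_complete) auto
  finally show ?thesis .
qed

definition partial_sq :: "nat \<Rightarrow> int \<Rightarrow> (real \<Rightarrow> real) \<Rightarrow> real \<Rightarrow> real" where
  "partial_sq N n \<phi> x = (\<Sum>i<N. (jump (n - int i) (cell_index (n - int i) x) \<phi>)\<^sup>2)"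

lemma partial_sq_0 [simp]: "partial_sq 0 n \<phi> x = 0"
  by (simp add: partial_sq_def)

lemma partial_sq_Suc:
  "partial_sq (Suc N) n \<phi> x = (jump n (cell_index n x) \<phi>)\<^sup>2 + partial_sq N (n - 1) \<phi> x"
  unfolding partial_sq_def by (subst sum.lessThan_Suc_shift) (simp add: algebra_simps)

lemma partial_sq_mono: "N \<le> M \<Longrightarrow> partial_sq N n \<phi> x \<le> partial_sq M n \<phi> x"
  unfolding partial_sq_def by (rule sum_mono2) auto

lemma sq_fun2_SUP:
  assumes "x \<in> cell n k"
  shows "sq_fun2 (cell n k) \<phi> x = (SUP N. ennreal (partial_sq N n \<phi> x))"
  unfolding sq_fun2_suminf[OF assms] suminf_eq_SUP by (simp add: partial_sq_def)

lemma sq_fun2_step: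
  assumes "x \<in> cell n k" "x \<in> cell (n - 1) j"
  shows "sq_fun2 (cell n k) \<phi> x = ennreal ((jump n k \<phi>)\<^sup>2) + sq_fun2 (cell (n - 1) j) \<phi> x"
proof -
  define g where "g i = ennreal ((jump (n - int i) (cell_index (n - int i) x) \<phi>)\<^sup>2)" for i
  have "cell_index n x = k" using assms(1) by (simp only: mem_cell_iff)
  then have "g 0 = ennreal ((jump n k \<phi>)\<^sup>2)" by (simp add: g_def)
  moreover have "sq_fun2 (cell n k) \<phi> x = suminf g"
    unfolding sq_fun2_suminf[OF assms(1)] g_def ..
  moreover have "sq_fun2 (cell (n - 1) j) \<phi> x = (\<Sum>i. g (i + 1))"
    unfolding sq_fun2_suminf[OF assms(2)] g_def by (rule suminf_cong) (simp add: diff_diff_eq)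
  ultimately show ?thesis
    using suminf_offset[of g 1] by (simp add: add.commute)
qed

section \<open>Measurability, and averages over the halves of a cell\<close>

lemma cell_index_measurable [measurable]: "cell_index n \<in> measurable lebesgue (count_space UNIV)"
proof -
  have "cell_index n \<in> measurable lborel (count_space UNIV)"
    unfolding cell_index_def[abs_def] by measurable
  then show ?thesis by (rule measurable_completion)
qed

lemma partial_sq_measurable [measurable]: "partial_sq N n \<phi> \<in> borel_measurable lebesgue"
proof (induction N arbitrary: n)
  case (Suc N)
  \<comment> \<open>The jump depends on x only through an integer index, and every function of that
    index is measurable.\<close>
  have "(\<lambda>x. (jump n (cell_index n x) \<phi>)\<^sup>2) \<in> borel_measurable lebesgue"
    by (rule measurable_compose[OF cell_index_measurable]) simp
  then show ?case using Suc by (subst partial_sq_Suc[abs_def]) simp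
qed (simp add: partial_sq_0[abs_def])

lemma sq_fun2_level_measurable: "{x \<in> cell n k. ennreal l \<le> sq_fun2 (cell n k) \<phi> x} \<in> sets lebesgue"
proof -
  have "{x \<in> cell n k. ennreal l \<le> sq_fun2 (cell n k) \<phi> x}
      = cell n k \<inter> {x \<in> space lebesgue. ennreal l \<le> (SUP N. ennreal (partial_sq N n \<phi> x))}"
    by (auto simp: sq_fun2_SUP)
  also have "\<dots> \<in> sets lebesgue" by measurable
  finally show ?thesis .
qed

lemma integrable_cell:
  fixes \<phi> :: "real \<Rightarrow> real"
  assumes "integrable lebesgue \<phi>"
  shows "set_integrable lebesgue (cell n k) \<phi>"
  using assms integrable_mult_indicator[of "cell n k" lebesgue \<phi>] by (simp add: set_integrable_def)

lemma integral_cell_split: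
  fixes \<phi> :: "real \<Rightarrow> real"
  assumes "integrable lebesgue \<phi>"
  shows "(LINT x:cell n k|lebesgue. \<phi> x) =
    (LINT x:cell (n - 1) (2 * k)|lebesgue. \<phi> x) + (LINT x:cell (n - 1) (2 * k + 1)|lebesgue. \<phi> x)"
  unfolding cell_split[of n k]
  by (rule set_integral_Un[OF cell_halves_disjoint integrable_cell[OF assms] integrable_cell[OF assms]])

lemma avg_cell: "avg (cell n k) \<phi> = (LINT x:cell n k|lebesgue. \<phi> x) / 2 powi n"
  by (simp add: avg_def)

lemma avg_halves:
  assumes "integrable lebesgue \<phi>"
  shows "avg (cell (n - 1) (2 * k)) \<phi> = avg (cell n k) \<phi> - jump n k \<phi>"
    "avg (cell (n - 1) (2 * k + 1)) \<phi> = avg (cell n k) \<phi> + jump n k \<phi>"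
proof -
  have "avg (cell n k) \<phi> = (avg (cell (n - 1) (2 * k)) \<phi> + avg (cell (n - 1) (2 * k + 1)) \<phi>) / 2"
    by (simp add: avg_cell integral_cell_split[OF assms, of n k] powi_2_pred[of n] add_divide_distrib)
  then show "avg (cell (n - 1) (2 * k)) \<phi> = avg (cell n k) \<phi> - jump n k \<phi>"
    "avg (cell (n - 1) (2 * k + 1)) \<phi> = avg (cell n k) \<phi> + jump n k \<phi>"
    by (simp_all add: jump_def field_simps)
qed

section \<open>The weak-type inequality\<close>

lemma measure_cell_split:
  assumes "{x \<in> cell (n - 1) (2 * k). P x} \<in> sets lebesgue" "{x \<in> cell (n - 1) (2 * k + 1). P x} \<in> sets lebesgue"
  shows "measure lebesgue {x \<in> cell n k. P x} =
    measure lebesgue {x \<in> cell (n - 1) (2 * k). P x} + measure lebesgue {x \<in> cell (n - 1) (2 * k + 1). P x}"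
proof -
  let ?L = "{x \<in> cell (n - 1) (2 * k). P x}" and ?R = "{x \<in> cell (n - 1) (2 * k + 1). P x}"
  have "?L \<in> lmeasurable" "?R \<in> lmeasurable"
    by (rule fmeasurableI2[OF lmeasurable_cell _ assms(1)], blast)
      (rule fmeasurableI2[OF lmeasurable_cell _ assms(2)], blast)
  then have "emeasure lebesgue ?L \<noteq> \<infinity>" "emeasure lebesgue ?R \<noteq> \<infinity>"
    by (auto simp: fmeasurable_def)
  moreover have "?L \<inter> ?R = {}" using cell_halves_disjoint[of "n - 1" k] by blast
  ultimately have "measure lebesgue (?L \<union> ?R) = measure lebesgue ?L + measure lebesgue ?R"
    using assms by (intro measure_Union) simp_all
  moreover have "{x \<in> cell n k. P x} = ?L \<union> ?R" using cell_split[of n k] by blast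
  ultimately show ?thesis by simp
qed

text \<open>\<open>bell_average\<close> is applied at the top split and the induction hypothesis to
  both halves with residual level c - d^2. The level l stays fixed, so the price per unit of
  unfinished measure is the same at every depth.\<close>

lemma bell_le_integral:
  assumes "integrable lebesgue \<phi>" "c \<le> l" "0 \<le> l"
  shows "2 powi n * bell (avg (cell n k) \<phi>) c \<le> (LINT x:cell n k|lebesgue. \<bar>\<phi> x\<bar>)
     + sqrt l / psi 1 * measure lebesgue {x \<in> cell n k. partial_sq N n \<phi> x < c}"
  using assms(2)
proof (induction N arbitrary: n k c)
  case 0
  let ?A = "avg (cell n k) \<phi>"
  have "norm (LINT x:cell n k|lebesgue. \<phi> x) \<le> (LINT x:cell n k|lebesgue. norm (\<phi> x))"
    by (rule set_integral_norm_bound[OF integrable_cell[OF assms(1)]])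
  then have A: "2 powi n * \<bar>?A\<bar> \<le> (LINT x:cell n k|lebesgue. \<bar>\<phi> x\<bar>)"
    by (simp add: avg_cell abs_divide)
  show ?case
  \<comment> \<open>No jump has been counted, so the unfinished set is empty if c \<le> 0 and the
    whole cell otherwise.\<close>
  proof (cases "c \<le> 0")
    case True
    then have "c \<le> ?A\<^sup>2" using zero_le_power2[of ?A] by linarith
    then have "bell ?A c = \<bar>?A\<bar>" by (simp add: bell_def)
    then show ?thesis using A True by simp
  next
    case False
    have "bell ?A c \<le> \<bar>?A\<bar> + sqrt c / psi 1" using bell_le_abs_plus[of c ?A] False by simp
    also have "\<dots> \<le> \<bar>?A\<bar> + sqrt l / psi 1"
      using 0 psi_pos[of 1] by (simp add: divide_right_mono)
    finally have "2 powi n * bell ?A c \<le> 2 powi n * (\<bar>?A\<bar> + sqrt l / psi 1)"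
      by (intro mult_left_mono) auto
    then show ?thesis using A False by (simp add: algebra_simps)
  qed
next
  case (Suc N)
  define d where "d = jump n k \<phi>"
  define c' where "c' = c - d\<^sup>2"
  let ?A = "avg (cell n k) \<phi>"
  let ?K = "sqrt l / psi 1"
  let ?m = "\<lambda>j. measure lebesgue {x \<in> cell (n - 1) j. partial_sq N (n - 1) \<phi> x < c'}"
  let ?I = "\<lambda>j. (LINT x:cell (n - 1) j|lebesgue. \<bar>\<phi> x\<bar>)"
  have c': "c' \<le> l" using Suc.prems zero_le_power2[of d] unfolding c'_def by linarith
  have lev: "{x \<in> cell n k. partial_sq (Suc N) n \<phi> x < c} = {x \<in> cell n k. partial_sq N (n - 1) \<phi> x < c'}"
    by (auto simp: partial_sq_Suc mem_cell_iff c'_def d_def)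
  have "2 powi n * bell ?A c \<le> 2 powi n * ((bell (?A + d) c' + bell (?A - d) c') / 2)"
    unfolding c'_def by (intro mult_left_mono bell_average) simp
  also have "\<dots> = 2 powi (n - 1) * bell (?A - d) c' + 2 powi (n - 1) * bell (?A + d) c'"
    by (simp add: powi_2_pred[of n] algebra_simps)
  also have "\<dots> \<le> (?I (2 * k) + ?K * ?m (2 * k)) + (?I (2 * k + 1) + ?K * ?m (2 * k + 1))"
    using Suc.IH[OF c', of "n - 1" "2 * k"] Suc.IH[OF c', of "n - 1" "2 * k + 1"]
    unfolding avg_halves[OF assms(1)] d_def by (rule add_mono)
  also have "\<dots> = (LINT x:cell n k|lebesgue. \<bar>\<phi> x\<bar>) + ?K * (?m (2 * k) + ?m (2 * k + 1))"
    using integral_cell_split[of "\<lambda>x. \<bar>\<phi> x\<bar>" n k] assms(1) by (simp add: algebra_simps)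
  also have "?m (2 * k) + ?m (2 * k + 1) = measure lebesgue {x \<in> cell n k. partial_sq (Suc N) n \<phi> x < c}"
    unfolding lev by (rule measure_cell_split[symmetric]) measurable
  finally show ?case .
qed

lemma weak_type_integral:
  assumes "integrable lebesgue \<phi>" "avg (cell n k) \<phi> = 0" "0 < l"
  shows "sqrt l / psi 1 * measure lebesgue {x \<in> cell n k. ennreal l \<le> sq_fun2 (cell n k) \<phi> x}
     \<le> (LINT x:cell n k|lebesgue. \<bar>\<phi> x\<bar>)"
proof -
  let ?E = "{x \<in> cell n k. ennreal l \<le> sq_fun2 (cell n k) \<phi> x}"
  let ?I = "LINT x:cell n k|lebesgue. \<bar>\<phi> x\<bar>"
  \<comment> \<open>A point may reach level \<open>l\<close> only in the limit of the partial sums, whence the smaller level \<open>c\<close>.\<close>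
  have below: "sqrt c / psi 1 * measure lebesgue ?E \<le> ?I" if c: "0 < c" "c < l" for c
  proof -
    let ?B = "\<lambda>N. {x \<in> cell n k. c \<le> partial_sq N n \<phi> x}"
    have K: "0 \<le> sqrt c / psi 1" using c psi_pos[of 1] by simp
    have lm: "?B N \<in> sets lebesgue" for N by measurable
    have fm: "?B N \<in> lmeasurable" for N by (rule fmeasurableI2[OF lmeasurable_cell _ lm]) auto
    have B: "sqrt c / psi 1 * measure lebesgue (?B N) \<le> ?I" for N
    proof -
      define K where "K = sqrt c / psi 1"
      have "{x \<in> cell n k. partial_sq N n \<phi> x < c} = cell n k - ?B N" by auto
      moreover have "measure lebesgue (cell n k - ?B N) = 2 powi n - measure lebesgue (?B N)"
        using measurable_measure_Diff[of "cell n k" lebesgue "?B N"] fm[of N] lm[of N] by auto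
      moreover have "bell 0 c = K" using c by (simp add: bell_def heat_def K_def)
      \<comment> \<open>The starting value K at mean 0 equals the price of unfinished measure, so
        the two terms with 2 powi n cancel.\<close>
      ultimately have "2 powi n * K \<le> ?I + K * (2 powi n - measure lebesgue (?B N))"
        using bell_le_integral[OF assms(1), of c c n k N] assms(2) c by (simp add: K_def)
      then show ?thesis unfolding K_def[symmetric] by (simp add: algebra_simps)
    qed
    have UB: "(\<Union>N. ?B N) \<in> lmeasurable"
      by (rule fmeasurableI2[OF lmeasurable_cell]) (use lm in \<open>auto intro!: sets.countable_UN\<close>)
    have "(\<lambda>N. measure lebesgue (?B N)) \<longlonglongrightarrow> measure lebesgue (\<Union>N. ?B N)"
      using lm UB by (intro Lim_measure_incseq)
        (auto simp: incseq_def fmeasurable_def intro: order_trans[OF _ partial_sq_mono])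
    then have "(\<lambda>N. sqrt c / psi 1 * measure lebesgue (?B N)) \<longlonglongrightarrow> sqrt c / psi 1 * measure lebesgue (\<Union>N. ?B N)"
      by (rule tendsto_mult_left)
    then have U: "sqrt c / psi 1 * measure lebesgue (\<Union>N. ?B N) \<le> ?I"
      by (rule LIMSEQ_le_const2) (use B in blast)
    have "?E \<subseteq> (\<Union>N. ?B N)"
    proof
      fix x assume x: "x \<in> ?E"
      have "ennreal c < ennreal l" using c by (simp add: ennreal_lessI)
      also have "\<dots> \<le> (SUP N. ennreal (partial_sq N n \<phi> x))" using x sq_fun2_SUP[of x n k \<phi>] by auto
      finally obtain N where "ennreal c < ennreal (partial_sq N n \<phi> x)" by (auto simp: less_SUP_iff)
      then have "c \<le> partial_sq N n \<phi> x" using c by (simp add: ennreal_less_iff)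
      then show "x \<in> (\<Union>N. ?B N)" using x by auto
    qed
    then have "measure lebesgue ?E \<le> measure lebesgue (\<Union>N. ?B N)"
      by (rule measure_mono_fmeasurable[OF _ sq_fun2_level_measurable UB])
    from mult_left_mono[OF this K] U show ?thesis by linarith
  qed
  have "((\<lambda>c. sqrt c / psi 1 * measure lebesgue ?E) \<longlongrightarrow> sqrt l / psi 1 * measure lebesgue ?E) (at_left l)"
    using psi_pos[of 1] by (intro tendsto_intros) auto
  moreover have "\<forall>\<^sub>F c in at_left l. sqrt c / psi 1 * measure lebesgue ?E \<le> ?I"
    using eventually_at_left_real[OF assms(3)] by eventually_elim (use below in auto)
  ultimately show ?thesis by (rule tendsto_upperbound) simp
qed

lemma weak_type:
  assumes "integrable lebesgue \<phi>" "avg (cell n k) \<phi> = 0" "0 < l"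
  shows "sqrt l / psi 1 * level_frac (cell n k) \<phi> l \<le> avg (cell n k) (\<lambda>x. \<bar>\<phi> x\<bar>)"
  using divide_right_mono[OF weak_type_integral[OF assms], of "2 powi n"]
  by (simp add: level_frac_def avg_cell)

section \<open>Realising finite splittings by functions\<close>

lemma avg_cong: "(\<And>x. x \<in> I \<Longrightarrow> \<phi> x = \<psi> x) \<Longrightarrow> avg I \<phi> = avg I \<psi>"
  unfolding avg_def set_lebesgue_integral_def by (auto intro!: Bochner_Integration.integral_cong simp: indicator_def)

lemma sq_fun2_cong:
  assumes "\<And>x. x \<in> cell n k \<Longrightarrow> \<phi> x = \<psi> x"
  shows "sq_fun2 (cell n k) \<phi> x = sq_fun2 (cell n k) \<psi> x"
  unfolding sq_fun2_def
proof (rule infsum_cong)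
  fix I assume "I \<in> {I \<in> dyadic. I \<subseteq> cell n k}"
  then obtain m j where I: "I = cell m j" "cell m j \<subseteq> cell n k" by (auto simp: dyadic_iff)
  then have "avg (left_half I) \<phi> = avg (left_half I) \<psi>" "avg (right_half I) \<phi> = avg (right_half I) \<psi>"
    using cell_split[of m j] assms unfolding left_half_cell right_half_cell I(1)
    by (blast intro: avg_cong)+
  then show "ennreal (\<bar>mart_diff I \<phi> x\<bar>\<^sup>2 * indicator I x) = ennreal (\<bar>mart_diff I \<psi> x\<bar>\<^sup>2 * indicator I x)"
    by (simp add: mart_diff_def)
qed

text \<open>Quantifying over all cells lets the two halves of a cell carry functions obtained by
  induction, with no separate translation or dilation argument.\<close>

definition attains :: "real \<Rightarrow> real \<Rightarrow> real \<Rightarrow> bool" where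
  "attains x l e \<longleftrightarrow> (\<forall>n k. \<exists>\<phi>. integrable_supp (cell n k) \<phi> \<and> avg (cell n k) \<phi> = x
     \<and> avg (cell n k) (\<lambda>t. \<bar>\<phi> t\<bar>) = e \<and> (\<forall>t\<in>cell n k. ennreal l \<le> sq_fun2 (cell n k) \<phi> t))"

lemma attainsE:
  assumes "attains x l e"
  obtains \<phi> where "integrable_supp (cell n k) \<phi>" "avg (cell n k) \<phi> = x"
    "avg (cell n k) (\<lambda>t. \<bar>\<phi> t\<bar>) = e" "\<And>t. t \<in> cell n k \<Longrightarrow> ennreal l \<le> sq_fun2 (cell n k) \<phi> t"
proof -
  from assms have "\<exists>\<phi>. integrable_supp (cell n k) \<phi> \<and> avg (cell n k) \<phi> = x
     \<and> avg (cell n k) (\<lambda>t. \<bar>\<phi> t\<bar>) = e \<and> (\<forall>t\<in>cell n k. ennreal l \<le> sq_fun2 (cell n k) \<phi> t)"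
    unfolding attains_def by (elim allE)
  then show thesis by (elim exE conjE) (rule that, auto)
qed

lemma attains_stop:
  assumes "l \<le> 0"
  shows "attains x l \<bar>x\<bar>"
  unfolding attains_def
proof (intro allI)
  fix n k
  let ?\<phi> = "\<lambda>t. x * indicator (cell n k) t"
  have i: "integrable lebesgue (indicator (cell n k) :: real \<Rightarrow> real)"
    by (rule integrable_real_indicator) (simp_all add: emeasure_cell)
  have c: "avg (cell n k) (\<lambda>_. c) = c" for c
    by (simp add: avg_cell set_integral_const emeasure_cell)
  have "integrable_supp (cell n k) ?\<phi>"
    using i by (simp add: integrable_supp_def)
  moreover have "avg (cell n k) ?\<phi> = x"
    using avg_cong[of "cell n k" ?\<phi> "\<lambda>_. x"] c by simp
  moreover have "avg (cell n k) (\<lambda>t. \<bar>?\<phi> t\<bar>) = \<bar>x\<bar>"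
    using avg_cong[of "cell n k" "\<lambda>t. \<bar>?\<phi> t\<bar>" "\<lambda>_. \<bar>x\<bar>"] c by simp
  ultimately show "\<exists>\<phi>. integrable_supp (cell n k) \<phi> \<and> avg (cell n k) \<phi> = x
     \<and> avg (cell n k) (\<lambda>t. \<bar>\<phi> t\<bar>) = \<bar>x\<bar> \<and> (\<forall>t\<in>cell n k. ennreal l \<le> sq_fun2 (cell n k) \<phi> t)"
    using assms by (intro exI[of _ ?\<phi>]) (simp add: ennreal_neg)
qed

lemma avg_eq_mean_halves:
  assumes "integrable lebesgue \<phi>"
  shows "avg (cell n k) \<phi> = (avg (cell (n - 1) (2 * k)) \<phi> + avg (cell (n - 1) (2 * k + 1)) \<phi>) / 2"
  using avg_halves[OF assms, of n k] by simp

lemma attains_split: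
  assumes "attains (x - d) (l - d\<^sup>2) e1" "attains (x + d) (l - d\<^sup>2) e2"
  shows "attains x l ((e1 + e2) / 2)"
  unfolding attains_def
proof (intro allI)
  fix n k
  let ?J = "cell n k" and ?L = "cell (n - 1) (2 * k)" and ?R = "cell (n - 1) (2 * k + 1)"
  obtain \<phi>1 where 1: "integrable_supp ?L \<phi>1" "avg ?L \<phi>1 = x - d" "avg ?L (\<lambda>t. \<bar>\<phi>1 t\<bar>) = e1"
    "\<And>t. t \<in> ?L \<Longrightarrow> ennreal (l - d\<^sup>2) \<le> sq_fun2 ?L \<phi>1 t"
    using attainsE[OF assms(1), of "n - 1" "2 * k"] by blast
  obtain \<phi>2 where 2: "integrable_supp ?R \<phi>2" "avg ?R \<phi>2 = x + d" "avg ?R (\<lambda>t. \<bar>\<phi>2 t\<bar>) = e2"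
    "\<And>t. t \<in> ?R \<Longrightarrow> ennreal (l - d\<^sup>2) \<le> sq_fun2 ?R \<phi>2 t"
    using attainsE[OF assms(2), of "n - 1" "2 * k + 1"] by blast
  define \<phi> where "\<phi> t = \<phi>1 t + \<phi>2 t" for t
  have out: "\<phi>1 t = 0" if "t \<notin> ?L" for t using 1(1) that unfolding integrable_supp_def by blast
  have out': "\<phi>2 t = 0" if "t \<notin> ?R" for t using 2(1) that unfolding integrable_supp_def by blast
  have int: "integrable lebesgue \<phi>"
    using 1(1) 2(1) unfolding integrable_supp_def \<phi>_def[abs_def] by (blast intro: Bochner_Integration.integrable_add)
  have supp: "integrable_supp ?J \<phi>"
    unfolding integrable_supp_def
  proof (intro conjI allI impI int)
    fix t assume "t \<notin> ?J"
    then show "\<phi> t = 0" using out[of t] out'[of t] cell_split[of n k] by (simp add: \<phi>_def)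
  qed
  have int': "integrable lebesgue (\<lambda>t. \<bar>\<phi> t\<bar>)" using int by (rule integrable_abs)
  have L: "\<phi> t = \<phi>1 t" if "t \<in> ?L" for t
    using out'[of t] that cell_halves_disjoint[of "n - 1" k] by (auto simp: \<phi>_def)
  have R: "\<phi> t = \<phi>2 t" if "t \<in> ?R" for t
    using out[of t] that cell_halves_disjoint[of "n - 1" k] by (auto simp: \<phi>_def)
  have aL: "avg ?L \<phi> = x - d" "avg ?L (\<lambda>t. \<bar>\<phi> t\<bar>) = e1"
    unfolding 1(2)[symmetric] 1(3)[symmetric] by (intro avg_cong, simp add: L)+
  have aR: "avg ?R \<phi> = x + d" "avg ?R (\<lambda>t. \<bar>\<phi> t\<bar>) = e2"
    unfolding 2(2)[symmetric] 2(3)[symmetric] by (intro avg_cong, simp add: R)+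
  have j: "jump n k \<phi> = d" by (simp add: jump_def aL aR)
  \<comment> \<open>The residual level l - d^2 may be negative, and \<open>ennreal\<close> sends it
    to 0; the maximum with 0 keeps the addition valid.\<close>
  have add: "ennreal l \<le> ennreal (d\<^sup>2) + s" if "ennreal (l - d\<^sup>2) \<le> s" for s
  proof -
    have "ennreal l \<le> ennreal (d\<^sup>2 + max 0 (l - d\<^sup>2))" by (intro ennreal_leI) auto
    also have "\<dots> = ennreal (d\<^sup>2) + ennreal (max 0 (l - d\<^sup>2))" by (rule ennreal_plus) simp_all
    also have "\<dots> = ennreal (d\<^sup>2) + ennreal (l - d\<^sup>2)" by (cases "l \<le> d\<^sup>2") (simp_all add: max_def ennreal_neg)
    also have "\<dots> \<le> ennreal (d\<^sup>2) + s" using that by (rule add_left_mono)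
    finally show ?thesis .
  qed
  have "ennreal l \<le> sq_fun2 ?J \<phi> t" if t: "t \<in> ?J" for t
  proof (cases "t \<in> ?L")
    case True
    have "sq_fun2 ?J \<phi> t = ennreal (d\<^sup>2) + sq_fun2 ?L \<phi>1 t"
      unfolding sq_fun2_step[OF t True] j using sq_fun2_cong[OF L] by simp
    then show ?thesis using add[OF 1(4)[OF True]] by simp
  next
    case False
    then have R': "t \<in> ?R" using t cell_split[of n k] by blast
    have "sq_fun2 ?J \<phi> t = ennreal (d\<^sup>2) + sq_fun2 ?R \<phi>2 t"
      unfolding sq_fun2_step[OF t R'] j using sq_fun2_cong[OF R] by simp
    then show ?thesis using add[OF 2(4)[OF R']] by simp
  qed
  moreover have "avg ?J \<phi> = x" "avg ?J (\<lambda>t. \<bar>\<phi> t\<bar>) = (e1 + e2) / 2"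
    by (simp_all add: avg_eq_mean_halves[OF int, of n k] avg_eq_mean_halves[OF int', of n k] aL aR)
  ultimately show "\<exists>\<phi>. integrable_supp ?J \<phi> \<and> avg ?J \<phi> = x
     \<and> avg ?J (\<lambda>t. \<bar>\<phi> t\<bar>) = (e1 + e2) / 2 \<and> (\<forall>t\<in>?J. ennreal l \<le> sq_fun2 ?J \<phi> t)"
    using supp by blast
qed

lemma reach_imp_attains: "reach x l e \<Longrightarrow> attains x l e"
  by (induction rule: reach.induct) (auto intro: attains_stop attains_split)

lemma reach_scale:
  assumes "reach x l e" "0 < t"
  shows "reach (t * x) (t\<^sup>2 * l) (t * e)"
  using assms(1)
proof (induction rule: reach.induct)
  case (stop l x)
  then have "reach (t * x) (t\<^sup>2 * l) \<bar>t * x\<bar>" by (intro reach.stop) (simp add: mult_nonneg_nonpos)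
  then show ?case using assms(2) by (simp add: abs_mult)
next
  case (split x d l e1 e2)
  then have "reach (t * x) (t\<^sup>2 * l) ((t * e1 + t * e2) / 2)"
    by (intro reach.split[where d = "t * d"]) (simp_all add: algebra_simps power_mult_distrib)
  then show ?case by (simp add: algebra_simps)
qed

text \<open>For p in [0, 1) this is binary digit i + 1 after the point, so its weight is
  \<open>(1 / 2) ^ Suc i\<close>.\<close>

definition bit_at :: "real \<Rightarrow> nat \<Rightarrow> int" where
  "bit_at p i = \<lfloor>2 ^ Suc i * p\<rfloor> - 2 * \<lfloor>2 ^ i * p\<rfloor>"

lemma bit_at_cases: "bit_at p i = 0 \<or> bit_at p i = 1"
proof -
  have "\<lfloor>2 * y\<rfloor> - 2 * \<lfloor>y\<rfloor> = 0 \<or> \<lfloor>2 * y\<rfloor> - 2 * \<lfloor>y\<rfloor> = 1" for y :: real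
    by linarith
  from this[of "2 ^ i * p"] show ?thesis by (simp add: bit_at_def mult.assoc)
qed

text \<open>The partial sums telescope to floor(2^N p) / 2^N; p < 1 makes the integer part
  vanish.\<close>

lemma bit_at_sums:
  assumes "0 \<le> p" "p < 1"
  shows "(\<lambda>i. of_int (bit_at p i) * (1 / 2) ^ Suc i) sums p"
proof -
  have part: "(\<Sum>i<N. of_int (bit_at p i) * (1 / 2) ^ Suc i) = of_int \<lfloor>2 ^ N * p\<rfloor> / (2 ^ N :: real)" for N
  proof (induction N)
    case 0
    have "\<lfloor>p\<rfloor> = 0" using assms by (simp add: floor_eq_iff)
    then show ?case by simp
  next
    case (Suc N)
    then show ?case by (simp add: bit_at_def field_simps)
  qed
  have "(\<lambda>N. of_int \<lfloor>2 ^ N * p\<rfloor> / (2 ^ N :: real)) \<longlonglongrightarrow> p"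
  proof (rule real_tendsto_sandwich)
    show "(\<lambda>N. p - (1 / 2) ^ N) \<longlonglongrightarrow> p"
      by (rule tendsto_eq_intros LIMSEQ_power_zero | simp)+
    show "(\<lambda>N. p) \<longlonglongrightarrow> p" by simp
    show "\<forall>\<^sub>F N in sequentially. p - (1 / 2) ^ N \<le> of_int \<lfloor>2 ^ N * p\<rfloor> / (2 ^ N :: real)"
    proof (intro always_eventually allI)
      fix N
      have "2 ^ N * p - 1 \<le> of_int \<lfloor>2 ^ N * p\<rfloor>" by linarith
      from divide_right_mono[OF this, of "2 ^ N"]
      show "p - (1 / 2) ^ N \<le> of_int \<lfloor>2 ^ N * p\<rfloor> / (2 ^ N :: real)"
        by (simp add: diff_divide_distrib power_one_over)
    qed
    show "\<forall>\<^sub>F N in sequentially. of_int \<lfloor>2 ^ N * p\<rfloor> / (2 ^ N :: real) \<le> p"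
      by (intro always_eventually allI) (simp add: divide_le_eq mult.commute)
  qed
  then show ?thesis unfolding sums_def part .
qed

section \<open>Prescribing the level fraction\<close>

lemma powi_2_shift: "(2::real) powi (n - int m) = 2 powi n * (1 / 2) ^ m"
proof -
  have "(2::real) powi (n - int m) = 2 powi n / 2 powi int m" by (rule power_int_diff) simp
  also have "\<dots> = 2 powi n * (1 / 2) ^ m" by (simp only: power_int_of_nat power_one_over) simp
  finally show ?thesis .
qed

text \<open>The leftmost descendants of a cell. Their right halves, \<open>right_cell\<close>, are
  disjoint, have the relative lengths 2^-(i+1) of the binary digits, and cover the cell up to its
  left end point.\<close>

definition left_cell :: "int \<Rightarrow> int \<Rightarrow> nat \<Rightarrow> real set" where
  "left_cell n k i = cell (n - int i) (k * 2 ^ i)"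

definition right_cell :: "int \<Rightarrow> int \<Rightarrow> nat \<Rightarrow> real set" where
  "right_cell n k i = cell (n - int i - 1) (2 * (k * 2 ^ i) + 1)"

lemma left_cell_0: "left_cell n k 0 = cell n k"
  by (simp add: left_cell_def)

lemma left_cell_Suc: "left_cell n k (Suc i) = cell (n - int i - 1) (2 * (k * 2 ^ i))"
  by (simp add: left_cell_def)

lemma left_cell_split:
  "left_cell n k i = left_cell n k (Suc i) \<union> right_cell n k i"
  "left_cell n k (Suc i) \<inter> right_cell n k i = {}"
  unfolding left_cell_Suc right_cell_def left_cell_def[of n k i]
  by (rule cell_split, rule cell_halves_disjoint)

lemma left_cell_antimono: "i \<le> j \<Longrightarrow> left_cell n k j \<subseteq> left_cell n k i"
  by (rule lift_Suc_antimono_le[of "left_cell n k"]) (use left_cell_split(1) in blast)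

lemma right_cell_subset: "right_cell n k i \<subseteq> left_cell n k i" "right_cell n k i \<subseteq> cell n k"
proof -
  show 1: "right_cell n k i \<subseteq> left_cell n k i" using left_cell_split(1)[of n k i] by simp
  also have "\<dots> \<subseteq> cell n k" using left_cell_antimono[of 0 i n k] by (simp add: left_cell_0)
  finally show "right_cell n k i \<subseteq> cell n k" .
qed

lemma right_cell_disjoint:
  assumes "i \<noteq> j"
  shows "right_cell n k i \<inter> right_cell n k j = {}"
proof -
  have *: "right_cell n k i \<inter> right_cell n k j = {}" if "i < j" for i j
  proof -
    have "right_cell n k j \<subseteq> left_cell n k (Suc i)"
      using that by (intro order_trans[OF right_cell_subset(1) left_cell_antimono]) simp
    then show ?thesis using left_cell_split(2)[of n k i] by blast
  qed
  show ?thesis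
  proof (cases "i < j")
    case False
    then have "j < i" using assms by simp
    from *[OF this] show ?thesis by (simp only: Int_commute)
  qed (rule *)
qed

lemma in_right_cell_or_all_left:
  assumes "x \<in> cell n k"
  shows "(\<exists>i. x \<in> right_cell n k i) \<or> (\<forall>i. x \<in> left_cell n k i)"
proof -
  have "x \<in> left_cell n k i" if "\<forall>i. x \<notin> right_cell n k i" for i
  proof (induction i)
    case (Suc i)
    then show ?case using left_cell_split(1)[of n k i] that by blast
  qed (simp add: left_cell_0 assms)
  then show ?thesis by blast
qed

text \<open>Mean-zero functions on the right cells cause no jump along the left chain, so what is
  placed on one of them does not affect the square function on the others.\<close>

lemma sq_fun2_left_chain:
  assumes "\<And>i. jump (n - int i) (k * 2 ^ i) \<phi> = 0" "x \<in> left_cell n k i"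
  shows "sq_fun2 (cell n k) \<phi> x = sq_fun2 (left_cell n k i) \<phi> x"
  using assms(2)
proof (induction i)
  case (Suc i)
  then have "x \<in> left_cell n k i" using left_cell_antimono[of i "Suc i" n k] by auto
  then show ?case
    using Suc sq_fun2_step[of x "n - int i" "k * 2 ^ i" "2 * (k * 2 ^ i)" \<phi>] assms(1)[of i]
    by (simp add: left_cell_Suc) (simp add: left_cell_def)
qed (simp add: left_cell_0)

lemma sq_fun2_right_cell:
  assumes "\<And>i. jump (n - int i) (k * 2 ^ i) \<phi> = 0" "x \<in> right_cell n k i"
  shows "sq_fun2 (cell n k) \<phi> x = sq_fun2 (right_cell n k i) \<phi> x"
proof -
  have x: "x \<in> left_cell n k i" using assms(2) right_cell_subset by blast
  show ?thesis
    using sq_fun2_left_chain[OF assms(1) x] sq_fun2_step[of x "n - int i" "k * 2 ^ i" "2 * (k * 2 ^ i) + 1" \<phi>]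
      assms(1)[of i] assms(2) x
    by (simp add: left_cell_def right_cell_def)
qed

lemma sq_fun2_all_left:
  assumes "\<And>i. jump (n - int i) (k * 2 ^ i) \<phi> = 0" "\<And>i. x \<in> left_cell n k i"
  shows "sq_fun2 (cell n k) \<phi> x = 0"
proof -
  have "cell_index (n - int i) x = k * 2 ^ i" for i
    using assms(2)[of i] by (simp add: left_cell_def mem_cell_iff)
  then show ?thesis
    using assms(2)[of 0] by (simp add: left_cell_0 sq_fun2_suminf assms(1))
qed

lemma sq_fun2_zero_fun: "sq_fun2 (cell n k) (\<lambda>_. 0) x = 0"
  unfolding sq_fun2_def by (rule infsum_0) (simp add: mart_diff_def avg_def)

text \<open>A mean-zero copy is put on \<open>right_cell n k i\<close> when digit i of p is 1, and
  zero otherwise. The level set is then exactly the union of the chosen cells, and the L^1 norm is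
  proportional to its measure.\<close>

lemma attains_fraction:
  assumes at: "attains 0 l e" and l: "0 < l" and p: "0 \<le> p" "p < 1"
  shows "\<exists>\<phi>. integrable_supp (cell n k) \<phi> \<and> avg (cell n k) \<phi> = 0
     \<and> avg (cell n k) (\<lambda>t. \<bar>\<phi> t\<bar>) = p * e \<and> level_frac (cell n k) \<phi> l = p"
proof -
  obtain \<Phi> where \<Phi>: "\<And>n k. integrable_supp (cell n k) (\<Phi> n k)" "\<And>n k. avg (cell n k) (\<Phi> n k) = 0"
    "\<And>n k. avg (cell n k) (\<lambda>t. \<bar>\<Phi> n k t\<bar>) = e" "\<And>n k t. t \<in> cell n k \<Longrightarrow> ennreal l \<le> sq_fun2 (cell n k) (\<Phi> n k) t"
    using at unfolding attains_def by metis
  let ?b = "\<lambda>i. real_of_int (bit_at p i)"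
  define f where "f i t = ?b i * \<Phi> (n - int i - 1) (2 * (k * 2 ^ i) + 1) t" for i t
  define \<phi> where "\<phi> t = (\<Sum>i. f i t)" for t
  have b: "?b i = 0 \<or> ?b i = 1" "\<bar>?b i\<bar> = ?b i" for i using bit_at_cases[of p i] by auto
  have f_int: "integrable lebesgue (f i)" for i
    using \<Phi>(1) unfolding f_def integrable_supp_def by simp
  have f_out: "f i t = 0" if "t \<notin> right_cell n k i" for i t
    using \<Phi>(1) that unfolding f_def integrable_supp_def right_cell_def by simp
  have f_other: "f j t = 0" if "t \<in> right_cell n k i" "j \<noteq> i" for i j t
    using f_out right_cell_disjoint[OF that(2), of n k] that(1) by blast
  have \<phi>_on: "\<phi> t = f i t" if "t \<in> right_cell n k i" for i t
  proof -
    have "(\<lambda>j. f j t) sums (\<Sum>j\<in>{i}. f j t)" using f_other[OF that] by (intro sums_finite) auto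
    then have "(\<lambda>j. f j t) sums f i t" by simp
    then show ?thesis unfolding \<phi>_def by (rule sums_unique[symmetric])
  qed
  have \<phi>_out: "\<phi> t = 0" if "\<And>i. t \<notin> right_cell n k i" for t
    using f_out that by (simp add: \<phi>_def)
  have supp_int: "(LINT t|lebesgue. h t) = (LINT t:right_cell n k i|lebesgue. h t)"
    if "\<And>t. t \<notin> right_cell n k i \<Longrightarrow> h t = 0" for h :: "real \<Rightarrow> real" and i
    unfolding set_lebesgue_integral_def using that
    by (intro Bochner_Integration.integral_cong) (auto simp: indicator_def)
  have m: "measure lebesgue (right_cell n k i) = 2 powi n * (1 / 2) ^ Suc i" for i
    using powi_2_shift[of n "Suc i"] by (simp add: right_cell_def diff_diff_eq add.commute)
  have int_f: "(LINT t|lebesgue. f i t) = 0" for i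
  proof -
    have "(LINT t|lebesgue. f i t) = (LINT t:right_cell n k i|lebesgue. f i t)"
      using f_out by (rule supp_int)
    also have "\<dots> = 0" using \<Phi>(2) by (simp add: f_def right_cell_def avg_cell)
    finally show ?thesis .
  qed
  have int_abs_f: "(LINT t|lebesgue. \<bar>f i t\<bar>) = 2 powi n * e * (?b i * (1 / 2) ^ Suc i)" for i
  proof -
    have "(LINT t|lebesgue. \<bar>f i t\<bar>) = (LINT t:right_cell n k i|lebesgue. \<bar>f i t\<bar>)"
      using f_out by (intro supp_int) simp
    also have "\<dots> = ?b i * (measure lebesgue (right_cell n k i) * e)"
      using \<Phi>(3)[of "n - int i - 1" "2 * (k * 2 ^ i) + 1"]
      by (simp add: f_def right_cell_def avg_cell abs_mult b field_simps)
    finally show ?thesis by (simp add: m)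
  qed
  have bs: "(\<lambda>i. ?b i * (1 / 2) ^ Suc i) sums p" by (rule bit_at_sums[OF p])
  then have sums_abs: "(\<lambda>i. LINT t|lebesgue. \<bar>f i t\<bar>) sums (2 powi n * e * p)"
    unfolding int_abs_f by (rule sums_mult)
  have fin: "\<exists>i. \<forall>j. j \<noteq> i \<longrightarrow> f j t = 0" for t
  proof (cases "\<exists>i. t \<in> right_cell n k i")
    case True
    then show ?thesis using f_other by blast
  next
    case False
    then show ?thesis using f_out by blast
  qed
  have summ: "summable (\<lambda>i. \<bar>f i t\<bar>)" for t
  proof -
    obtain i where "\<forall>j. j \<noteq> i \<longrightarrow> f j t = 0" using fin by blast
    then show ?thesis by (intro summable_finite[of "{i}"]) auto
  qed
  have abs_\<phi>: "\<bar>\<phi> t\<bar> = (\<Sum>i. \<bar>f i t\<bar>)" for t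
  proof -
    obtain i where i: "\<forall>j. j \<noteq> i \<longrightarrow> f j t = 0" using fin by blast
    have "\<phi> t = (\<Sum>j\<in>{i}. f j t)" unfolding \<phi>_def using i by (intro suminf_finite) auto
    moreover have "(\<Sum>i. \<bar>f i t\<bar>) = (\<Sum>j\<in>{i}. \<bar>f j t\<bar>)" using i by (intro suminf_finite) auto
    ultimately show ?thesis by simp
  qed
  \<comment> \<open>The L^1 norms of the pieces are summable by the binary expansion, which permits
    integrating the series termwise.\<close>
  note crit = f_int AE_I2[OF summ[folded real_norm_def]] sums_summable[OF sums_abs, folded real_norm_def]
  have \<phi>_int: "integrable lebesgue \<phi>"
    unfolding \<phi>_def[abs_def] by (rule integrable_suminf[OF crit])
  have supp: "integrable_supp (cell n k) \<phi>"
    using \<phi>_int \<phi>_out right_cell_subset(2)[of n k] unfolding integrable_supp_def by blast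
  have whole: "(LINT t:cell n k|lebesgue. h t) = (LINT t|lebesgue. h t)" if "\<And>t. t \<notin> cell n k \<Longrightarrow> h t = 0"
    for h :: "real \<Rightarrow> real"
    unfolding set_lebesgue_integral_def using that
    by (intro Bochner_Integration.integral_cong) (auto simp: indicator_def)
  have \<phi>0: "\<phi> t = 0" if "t \<notin> cell n k" for t using supp that by (simp add: integrable_supp_def)
  have "(LINT t|lebesgue. \<phi> t) = 0"
    unfolding \<phi>_def[abs_def] integral_suminf[OF crit] int_f by simp
  then have J0: "(LINT t:cell n k|lebesgue. \<phi> t) = 0" using whole[of \<phi>] \<phi>0 by simp
  have "(LINT t|lebesgue. \<bar>\<phi> t\<bar>) = (\<Sum>i. LINT t|lebesgue. \<bar>f i t\<bar>)"
    unfolding abs_\<phi> using crit by (intro integral_suminf) simp_all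
  also have "\<dots> = 2 powi n * e * p" using sums_abs by (rule sums_unique[symmetric])
  finally have J1: "(LINT t:cell n k|lebesgue. \<bar>\<phi> t\<bar>) = 2 powi n * e * p"
    using whole[of "\<lambda>t. \<bar>\<phi> t\<bar>"] \<phi>0 by simp
  have right0: "(LINT t:right_cell n k i|lebesgue. \<phi> t) = 0" for i
  proof -
    have "(LINT t:right_cell n k i|lebesgue. \<phi> t) = (LINT t:right_cell n k i|lebesgue. f i t)"
      unfolding set_lebesgue_integral_def using \<phi>_on
      by (intro Bochner_Integration.integral_cong) (auto simp: indicator_def)
    also have "\<dots> = (LINT t|lebesgue. f i t)" using f_out by (rule supp_int[symmetric])
    finally show ?thesis using int_f by simp
  qed
  \<comment> \<open>Removing mean-zero right halves one after another from a cell of integral 0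
    leaves integral 0 on every left cell.\<close>
  have left0: "(LINT t:left_cell n k i|lebesgue. \<phi> t) = 0" for i
  proof (induction i)
    case (Suc i)
    then show ?case
      using integral_cell_split[OF \<phi>_int, of "n - int i" "k * 2 ^ i"] right0[of i]
      unfolding left_cell_Suc right_cell_def left_cell_def[of n k i] by simp
  qed (simp add: left_cell_0 J0)
  have j0: "jump (n - int i) (k * 2 ^ i) \<phi> = 0" for i
    using left0[of "Suc i"] right0[of i] unfolding left_cell_Suc right_cell_def jump_def
    by (simp add: avg_cell)
  have sq: "sq_fun2 (cell n k) \<phi> t = sq_fun2 (right_cell n k i) (f i) t" if "t \<in> right_cell n k i" for t i
    using sq_fun2_right_cell[of n k \<phi> t i, OF j0 that] \<phi>_on
      sq_fun2_cong[of "n - int i - 1" "2 * (k * 2 ^ i) + 1" \<phi> "f i" t]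
    by (simp add: right_cell_def)
  define A where "A i = (if ?b i = 1 then right_cell n k i else {})" for i
  have level: "{t \<in> cell n k. ennreal l \<le> sq_fun2 (cell n k) \<phi> t} = (\<Union>i. A i)"
  proof (intro set_eqI iffI)
    fix t assume t: "t \<in> {t \<in> cell n k. ennreal l \<le> sq_fun2 (cell n k) \<phi> t}"
    \<comment> \<open>As l > 0, this excludes both the common point of all left cells and the right
      cells with digit 0.\<close>
    then have pos: "sq_fun2 (cell n k) \<phi> t \<noteq> 0" using l by (auto simp: ennreal_eq_0_iff)
    then obtain i where i: "t \<in> right_cell n k i"
      using in_right_cell_or_all_left[of t n k] sq_fun2_all_left[of n k \<phi> t, OF j0] t by blast
    have "?b i \<noteq> 0"
    proof
      assume "?b i = 0"
      then have "f i = (\<lambda>_. 0)" by (simp add: f_def fun_eq_iff)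
      then show False using pos sq[OF i] by (simp add: right_cell_def sq_fun2_zero_fun)
    qed
    then show "t \<in> (\<Union>i. A i)" using i b(1)[of i] by (auto simp: A_def)
  next
    fix t assume "t \<in> (\<Union>i. A i)"
    then obtain i where i: "?b i = 1" "t \<in> right_cell n k i" by (auto simp: A_def split: if_splits)
    then have "f i = \<Phi> (n - int i - 1) (2 * (k * 2 ^ i) + 1)" by (simp add: f_def fun_eq_iff)
    then have "ennreal l \<le> sq_fun2 (cell n k) \<phi> t"
      using \<Phi>(4) i(2) sq[OF i(2)] by (simp add: right_cell_def)
    then show "t \<in> {t \<in> cell n k. ennreal l \<le> sq_fun2 (cell n k) \<phi> t}"
      using i(2) right_cell_subset(2)[of n k i] by blast
  qed
  have A: "A i \<in> sets lebesgue" for i by (simp add: A_def right_cell_def)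
  have "(\<lambda>i. measure lebesgue (A i)) sums measure lebesgue (\<Union>i. A i)"
  proof (rule measure_UNION)
    show "range A \<subseteq> sets lebesgue" using A by blast
    show "disjoint_family A"
      using right_cell_disjoint[of _ _ n k] unfolding disjoint_family_on_def A_def by auto
    have "emeasure lebesgue (\<Union>i. A i) \<le> emeasure lebesgue (cell n k)"
      using right_cell_subset(2)[of n k] by (intro emeasure_mono) (auto simp: A_def split: if_splits)
    then show "emeasure lebesgue (\<Union>i. A i) \<noteq> \<infinity>"
      by (auto simp: emeasure_cell top_unique)
  qed
  moreover have "measure lebesgue (A i) = 2 powi n * (?b i * (1 / 2) ^ Suc i)" for i
    using b(1)[of i] m[of i] by (auto simp: A_def)
  ultimately have "(\<lambda>i. 2 powi n * (?b i * (1 / 2) ^ Suc i)) sums measure lebesgue (\<Union>i. A i)"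
    by simp
  then have "measure lebesgue (\<Union>i. A i) = 2 powi n * p"
    using sums_mult[OF bs, of "2 powi n"] by (rule sums_unique2)
  then have "level_frac (cell n k) \<phi> l = p"
    unfolding level_frac_def level by simp
  then show ?thesis
    using supp J0 J1 by (intro exI[of _ \<phi>]) (simp add: avg_cell)
qed

section \<open>The extremal functions\<close>

lemma level_frac_full:
  assumes "\<And>t. t \<in> cell n k \<Longrightarrow> ennreal l \<le> sq_fun2 (cell n k) \<phi> t"
  shows "level_frac (cell n k) \<phi> l = 1"
proof -
  have "{t \<in> cell n k. ennreal l \<le> sq_fun2 (cell n k) \<phi> t} = cell n k" using assms by blast
  then show ?thesis by (simp add: level_frac_def)
qed

lemma level_frac_le_1: "level_frac (cell n k) \<phi> l \<le> 1"
proof -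
  have "measure lebesgue {t \<in> cell n k. ennreal l \<le> sq_fun2 (cell n k) \<phi> t} \<le> measure lebesgue (cell n k)"
    by (rule measure_mono_fmeasurable[OF _ sq_fun2_level_measurable lmeasurable_cell]) blast
  then show ?thesis by (simp add: level_frac_def)
qed

text \<open>One e serves all fractions: p = 1 uses the function attaining e itself, p < 1 its
  copies. The weak-type inequality for that function bounds e from below. The splitting
  \<open>reach 0 l e\<close> is exported so that it can be rescaled.\<close>

lemma fraction_near_optimal:
  assumes "0 < l" "0 < \<eta>"
  obtains e where "0 < e" "sqrt l / psi 1 \<le> e" "e \<le> sqrt l / psi 1 + \<eta>" "reach 0 l e"
    "\<And>p. 0 \<le> p \<Longrightarrow> p \<le> 1 \<Longrightarrow> \<exists>\<phi>. integrable_supp (cell n k) \<phi> \<and> avg (cell n k) \<phi> = 0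
       \<and> avg (cell n k) (\<lambda>t. \<bar>\<phi> t\<bar>) = p * e \<and> level_frac (cell n k) \<phi> l = p"
proof -
  obtain e where e: "reach 0 l e" "e \<le> sqrt l / psi 1 + \<eta>" using reach_near_optimal[OF assms] by blast
  have at: "attains 0 l e" using e(1) by (rule reach_imp_attains)
  obtain \<phi> where \<phi>: "integrable_supp (cell n k) \<phi>" "avg (cell n k) \<phi> = 0" "avg (cell n k) (\<lambda>t. \<bar>\<phi> t\<bar>) = e"
    "\<And>t. t \<in> cell n k \<Longrightarrow> ennreal l \<le> sq_fun2 (cell n k) \<phi> t"
    using attainsE[OF at, of n k] by blast
  have one: "level_frac (cell n k) \<phi> l = 1" using \<phi>(4) by (rule level_frac_full)
  have K: "sqrt l / psi 1 \<le> e"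
    using weak_type[of \<phi> n k l] \<phi> one assms(1) by (simp add: integrable_supp_def)
  have "0 < sqrt l / psi 1" using assms(1) psi_pos[of 1] by simp
  then have pos: "0 < e" using K by linarith
  have frac: "\<exists>\<phi>. integrable_supp (cell n k) \<phi> \<and> avg (cell n k) \<phi> = 0
       \<and> avg (cell n k) (\<lambda>t. \<bar>\<phi> t\<bar>) = p * e \<and> level_frac (cell n k) \<phi> l = p" if p: "0 \<le> p" "p \<le> 1" for p
  proof (cases "p = 1")
    case True
    then show ?thesis using \<phi>(1-3) one by (intro exI[of _ \<phi>]) simp
  next
    case False
    then show ?thesis using attains_fraction[OF at assms(1) p(1)] p(2) by simp
  qed
  show thesis by (rule that[OF pos K e(2,1)]) (rule frac)
qed

lemma bellman_L_zero:
  assumes "0 < l" "0 \<le> p" "p \<le> 1"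
  shows "bellman_L (cell n k) 0 p l = p * (sqrt l / psi 1)"
proof -
  let ?S = "{avg (cell n k) (\<lambda>x. \<bar>\<phi> x\<bar>) | \<phi>. integrable_supp (cell n k) \<phi> \<and> avg (cell n k) \<phi> = 0 \<and> level_frac (cell n k) \<phi> l = p}"
  let ?K = "sqrt l / psi 1"
  have lower: "p * ?K \<le> y" if "y \<in> ?S" for y
    using that weak_type[of _ n k l] assms(1) by (auto simp: integrable_supp_def mult.commute)
  have near: "\<exists>e. e \<le> ?K + \<eta> \<and> p * e \<in> ?S" if \<eta>: "0 < \<eta>" for \<eta>
  proof -
    obtain e where "e \<le> ?K + \<eta>" "\<exists>\<phi>. integrable_supp (cell n k) \<phi> \<and> avg (cell n k) \<phi> = 0
       \<and> avg (cell n k) (\<lambda>t. \<bar>\<phi> t\<bar>) = p * e \<and> level_frac (cell n k) \<phi> l = p"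
      using fraction_near_optimal[OF assms(1) \<eta>, of n k] assms(2,3) by metis
    then show ?thesis by (intro exI[of _ e]) force
  qed
  have "bdd_below ?S" using lower by (rule bdd_belowI)
  have "Inf ?S \<le> p * ?K + \<eta>" if \<eta>: "0 < \<eta>" for \<eta>
  proof -
    obtain e where e: "e \<le> ?K + \<eta>" "p * e \<in> ?S" using near[OF \<eta>] by blast
    have "Inf ?S \<le> p * e" using e(2) \<open>bdd_below ?S\<close> by (rule cInf_lower)
    also have "\<dots> \<le> p * (?K + \<eta>)" using e(1) assms(2) by (rule mult_left_mono)
    also have "\<dots> \<le> p * ?K + \<eta>" using mult_right_mono[OF assms(3), of \<eta>] \<eta> by (simp add: distrib_left)
    finally show ?thesis .
  qed
  then have "Inf ?S \<le> p * ?K" by (rule field_le_epsilon)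
  moreover have "p * ?K \<le> Inf ?S"
  proof (rule cInf_greatest)
    show "?S \<noteq> {}" using near[of 1] by auto
  qed (rule lower)
  ultimately show ?thesis unfolding bellman_L_def by simp
qed

lemma bellman_M_small:
  assumes "0 < l" "0 \<le> F" "F \<le> sqrt l / psi 1"
  shows "bellman_M (cell n k) 0 F l = F / (sqrt l / psi 1)"
proof -
  let ?S = "{level_frac (cell n k) \<phi> l | \<phi>. integrable_supp (cell n k) \<phi> \<and> avg (cell n k) \<phi> = 0 \<and> avg (cell n k) (\<lambda>x. \<bar>\<phi> x\<bar>) = F}"
  let ?K = "sqrt l / psi 1"
  have K: "0 < ?K" using assms(1) psi_pos[of 1] by simp
  have upper: "y \<le> F / ?K" if y: "y \<in> ?S" for y
  proof -
    obtain \<phi> where \<phi>: "integrable_supp (cell n k) \<phi>" "avg (cell n k) \<phi> = 0" "avg (cell n k) (\<lambda>x. \<bar>\<phi> x\<bar>) = F"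
      "y = level_frac (cell n k) \<phi> l" using y by blast
    then have "?K * y \<le> F" using weak_type[of \<phi> n k l] assms(1) by (simp add: integrable_supp_def)
    then show ?thesis using K by (subst pos_le_divide_eq) (simp_all add: mult.commute)
  qed
  have near: "\<exists>e. 0 < e \<and> e \<le> ?K + \<eta> \<and> F / e \<in> ?S" if \<eta>: "0 < \<eta>" for \<eta>
  proof -
    obtain e where e: "0 < e" "?K \<le> e" "e \<le> ?K + \<eta>" and "reach 0 l e" and frac: "\<And>p. 0 \<le> p \<Longrightarrow> p \<le> 1 \<Longrightarrow> \<exists>\<phi>. integrable_supp (cell n k) \<phi> \<and> avg (cell n k) \<phi> = 0
       \<and> avg (cell n k) (\<lambda>t. \<bar>\<phi> t\<bar>) = p * e \<and> level_frac (cell n k) \<phi> l = p"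
      by (rule fraction_near_optimal[OF assms(1) \<eta>, of n k]) iprover
    \<comment> \<open>The fraction F / e makes the mean absolute value exactly F; it is at most 1
      because e is at least the threshold.\<close>
    have "F \<le> e" using e(2) assms(3) by linarith
    then have p: "0 \<le> F / e" "F / e \<le> 1" using e(1) assms(2) by (simp_all add: divide_le_eq)
    obtain \<phi> where \<phi>: "integrable_supp (cell n k) \<phi>" "avg (cell n k) \<phi> = 0"
      "avg (cell n k) (\<lambda>t. \<bar>\<phi> t\<bar>) = F / e * e" "level_frac (cell n k) \<phi> l = F / e"
      using frac[OF p] by blast
    have "F / e \<in> ?S"
      by (intro CollectI exI[of _ \<phi>]) (use \<phi> e(1) in simp)
    then show ?thesis using e(1,3) by blast
  qed
  have "bdd_above ?S" using upper by (rule bdd_aboveI)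
  have ge: "F / (?K + \<eta>) \<le> Sup ?S" if \<eta>: "0 < \<eta>" for \<eta>
  proof -
    obtain e where e: "0 < e" "e \<le> ?K + \<eta>" "F / e \<in> ?S" using near[OF \<eta>] by blast
    have "F / (?K + \<eta>) \<le> F / e"
      using e(1,2) assms(2) by (intro divide_left_mono) (auto intro: mult_pos_pos)
    also have "\<dots> \<le> Sup ?S" using e(3) \<open>bdd_above ?S\<close> by (rule cSup_upper)
    finally show ?thesis .
  qed
  have "((\<lambda>\<eta>. F / (?K + \<eta>)) \<longlongrightarrow> F / (?K + 0)) (at_right 0)"
    using K by (intro tendsto_intros) auto
  moreover have "\<forall>\<^sub>F \<eta> in at_right 0. F / (?K + \<eta>) \<le> Sup ?S"
    using eventually_at_right_less[of 0] by eventually_elim (rule ge)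
  ultimately have "F / (?K + 0) \<le> Sup ?S" by (rule tendsto_upperbound) simp
  moreover have "Sup ?S \<le> F / ?K"
  proof (rule cSup_least)
    show "?S \<noteq> {}" using near[of 1] by auto
  qed (rule upper)
  ultimately show ?thesis unfolding bellman_M_def by simp
qed

text \<open>The strict inequality leaves room for some e \<le> F. Scaling that splitting by F / e
  \<ge> 1 makes the mean absolute value F and only raises the level reached.\<close>

lemma bellman_M_large:
  assumes "0 < l" "sqrt l / psi 1 < F"
  shows "bellman_M (cell n k) 0 F l = 1"
proof -
  let ?S = "{level_frac (cell n k) \<phi> l | \<phi>. integrable_supp (cell n k) \<phi> \<and> avg (cell n k) \<phi> = 0 \<and> avg (cell n k) (\<lambda>x. \<bar>\<phi> x\<bar>) = F}"
  obtain e where e: "0 < e" "e \<le> sqrt l / psi 1 + (F - sqrt l / psi 1)" "reach 0 l e"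
    using fraction_near_optimal[OF assms(1), of "F - sqrt l / psi 1" n k] assms(2) by auto
  define t where "t = F / e"
  have t: "1 \<le> t" "t * e = F" using e(1,2) by (simp_all add: t_def)
  have "reach 0 (t\<^sup>2 * l) F" using reach_scale[OF e(3), of t] t by simp
  then have "attains 0 (t\<^sup>2 * l) F" by (rule reach_imp_attains)
  then obtain \<phi> where \<phi>: "integrable_supp (cell n k) \<phi>" "avg (cell n k) \<phi> = 0" "avg (cell n k) (\<lambda>t. \<bar>\<phi> t\<bar>) = F"
    "\<And>x. x \<in> cell n k \<Longrightarrow> ennreal (t\<^sup>2 * l) \<le> sq_fun2 (cell n k) \<phi> x"
    using attainsE[of 0 "t\<^sup>2 * l" F n k] by blast
  have "ennreal l \<le> ennreal (t\<^sup>2 * l)"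
    using mult_right_mono[of 1 "t\<^sup>2" l] t(1) assms(1) by (intro ennreal_leI) simp
  then have "level_frac (cell n k) \<phi> l = 1"
    by (intro level_frac_full) (rule order_trans[OF _ \<phi>(4)])
  then have "1 \<in> ?S" using \<phi>(1-3) by force
  moreover have "y \<le> 1" if "y \<in> ?S" for y using that level_frac_le_1 by blast
  ultimately show ?thesis unfolding bellman_M_def by (intro cSup_eq_maximum)
qed

theorem proposition4p2:
  fixes J :: "real set"
  assumes "J \<in> dyadic"
  shows "(\<forall>F lam :: real. F \<ge> 0 \<and> lam > 0 \<longrightarrow>
            (F \<le> sqrt lam / Psi 1 \<longrightarrow>
               bellman_M J 0 F lam = F / bellman_L J 0 1 lam \<and>
               F / bellman_L J 0 1 lam = F / sqrt lam * Psi 1) \<and>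
            (F > sqrt lam / Psi 1 \<longrightarrow> bellman_M J 0 F lam = 1)) \<and>
         (\<forall>p lam :: real. 0 \<le> p \<and> p \<le> 1 \<and> lam > 0 \<longrightarrow>
            bellman_L J 0 p lam = p * bellman_L J 0 1 lam \<and>
            p * bellman_L J 0 1 lam = p * sqrt lam / Psi 1)"
proof -
  obtain n k where J: "J = cell n k" using assms by (auto simp: dyadic_iff)
  show ?thesis
    unfolding J Psi_1 by (simp add: bellman_L_zero bellman_M_small bellman_M_large)
qed

end
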